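(* Let $m,n$ be positive integers and let $\mathbf{r}=(r_1,\ldots,r_n)$ be an $n$-tuple of non-negative integers with $r_1+\cdots+r_n=m$. Put $S_k=\sum_{i=1}^k r_i$ for $k=0,1,\ldots,n$ (so $S_0=0$, $S_n=m$). Then the $(q,t)$-generating function of $\mathbf{r}$-block diagonally symmetric lozenge tilings of $H(m,m,n)$ is $$\operatorname{M}_{q,t}^{\mathbf{r}}(H(m,m,n))=\prod_{i=1}^{m}(1+q^{i-1}t)\cdot q^{\alpha}\cdot t^{\beta}\cdot\frac{\prod_{1\le i<j\le n}[S_j-S_i+j-i]_q\cdot\prod_{i=1}^{n}[S_n+i-1]_q!}{\prod_{i=1}^{n}[S_i+i-1]_q!\,[S_n-S_i+n-i]_q!},$$ where $\alpha=\sum_{i=1}^{n}\binom{S_n-S_i}{2}$ and $\beta=\sum_{i=1}^{n}(S_n-S_i)$.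
   Context: Work on the triangular lattice with unit triangles of side $1$, one family of lattice lines vertical (so adjacent vertical lattice lines are at distance $\tfrac{\sqrt3}{2}$). A lozenge is the union of two adjacent unit triangles; lozenges are called horizontal, positive, or negative according to whether their long diagonal is horizontal, has positive slope, or has negative slope (positive and negative lozenges have two vertical sides). $H(a,b,c)$ denotes the hexagon on this lattice with side lengths $a,b,c,a,b,c$ in clockwise order starting from the top-left side. $H(m,m,n)$ is symmetric about its vertical diagonal $\ell$, which has length $m+n$. A $k$-cell is a region congruent to $H(1,1,k)$ (vertical diagonal of length $k+1$). Since $(r_1+1)+\cdots+(r_n+1)=m+n$, one can place uniquely, from bottom to top, an $r_1$-cell, an $r_2$-cell, ..., an $r_n$-cell inside $H(m,m,n)$, each bisected by $\ell$ and pairwise non-overlapping. A lozenge tiling of $H(m,m,n)$ is $\mathbf{r}$-block diagonally symmetric if it is symmetric about $\ell$ and, for each $i=1,\ldots,n$, the $r_i$-cell contains exactly $r_i$ full horizontal lozenges. Weight: given such a tiling, consider the lozenges lying strictly to the left of $\ell$; horizontal and positive ones get weight $1$, and a negative lozenge whose right vertical side is at distance $\tfrac{\sqrt3}{2}k$ from $\ell$ ($k\ge 0$) gets weight $q^{k}t$. The weight of the tiling is the product of these weights, and $\operatorname{M}_{q,t}^{\mathbf{r}}(H(m,m,n))$ is the sum of the weights of all $\mathbf{r}$-block diagonally symmetric lozenge tilings of $H(m,m,n)$. Notation: $[k]_q=\frac{1-q^k}{1-q}$, $[k]_q!=[k]_q[k-1]_q\cdots[1]_q$, $[0]_q!=1$.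 *)

theory Defs
  imports Complex_Main "HOL-Library.Disjoint_Sets"
begin

text \<open>
  The pair \<open>(x, h)\<close> with \<open>x + h\<close> even stands for the vertex \<open>(x \<cdot> \<surd>3/2, h/2)\<close> of the
  triangular lattice with side 1 and one family of vertical lattice lines. Thus vertical unit
  edges have length 2 in the second coordinate, and signs of slopes are preserved.
  A unit triangle is the set of its three vertices, and a region (in particular, a lozenge) is
  the set of the unit triangles that make it up.
\<close>

type_synonym point = "int \<times> int"
type_synonym triangle = "point set"
type_synonym region = "triangle set"

definition unit_triangles :: "triangle set" where
  "unit_triangles =
     {{(x, h), (x, h + 2), (x + 1, h + 1)} | x h. even (x + h)} \<union>
     {{(x, h), (x, h + 2), (x - 1, h + 1)} | x h. even (x + h)}"

text \<open>Two unit triangles are adjacent if they share an edge, that is, exactly two vertices.\<close>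

definition lozenge :: "region \<Rightarrow> bool" where
  "lozenge L \<longleftrightarrow>
     (\<exists>T\<in>unit_triangles. \<exists>T'\<in>unit_triangles. card (T \<inter> T') = 2 \<and> L = {T, T'})"

text \<open>
  The two triangles of a lozenge share its short diagonal; the endpoints of the long diagonal
  are the two vertices that are not shared.
\<close>

definition long_diagonal :: "region \<Rightarrow> point set" where
  "long_diagonal L = \<Union>L - \<Inter>L"

definition horizontal :: "region \<Rightarrow> bool" where
  "horizontal L \<longleftrightarrow> lozenge L \<and>
     (\<exists>x h x' h'. long_diagonal L = {(x, h), (x', h')} \<and> x < x' \<and> h = h')"

definition positive :: "region \<Rightarrow> bool" where
  "positive L \<longleftrightarrow> lozenge L \<and>
     (\<exists>x h x' h'. long_diagonal L = {(x, h), (x', h')} \<and> x < x' \<and> h < h')"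

definition negative :: "region \<Rightarrow> bool" where
  "negative L \<longleftrightarrow> lozenge L \<and>
     (\<exists>x h x' h'. long_diagonal L = {(x, h), (x', h')} \<and> x < x' \<and> h > h')"

text \<open>
  \<open>hexagon p a b c\<close> is \<open>H(a, b, c)\<close> (side lengths \<open>a, b, c, a, b, c\<close> clockwise from the top-left
  side) with its bottom corner at \<open>p\<close>. Relative to \<open>p\<close>, its corners, clockwise from the bottom,
  are \<open>(0, 0)\<close>, \<open>(-b, b)\<close>, \<open>(-b, b + 2c)\<close>, \<open>(a - b, a + b + 2c)\<close>, \<open>(a, a + 2c)\<close>, \<open>(a, a)\<close>.
  For \<open>a = b\<close> the vertical diagonal joins \<open>(0, 0)\<close> to \<open>(0, 2(a + c))\<close>.
\<close>

definition hexagon :: "point \<Rightarrow> nat \<Rightarrow> nat \<Rightarrow> nat \<Rightarrow> region" where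
  "hexagon p a b c = {T \<in> unit_triangles. \<forall>v\<in>T.
     (let x = fst v - fst p; h = snd v - snd p in
        - int b \<le> x \<and> x \<le> int a \<and> - x \<le> h \<and> x \<le> h \<and>
        h - x \<le> 2 * (int b + int c) \<and> h + x \<le> 2 * (int a + int c))}"

definition lozenge_tiling :: "region \<Rightarrow> region set \<Rightarrow> bool" where
  "lozenge_tiling R \<tau> \<longleftrightarrow> partition_on R \<tau> \<and> (\<forall>L\<in>\<tau>. lozenge L)"

text \<open>
  \<open>H(m, m, n)\<close> is placed with its bottom corner at the origin, so that its vertical diagonal
  lies on the line \<open>x = 0\<close>.
\<close>

definition reflect :: "point \<Rightarrow> point" where
  "reflect v = (- fst v, snd v)"

definition symmetric_tiling :: "region set \<Rightarrow> bool" where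
  "symmetric_tiling \<tau> \<longleftrightarrow> (\<lambda>L. (\<lambda>T. reflect ` T) ` L) ` \<tau> = \<tau>"

text \<open>
  The \<open>i\<close>-th cell (\<open>1 \<le> i \<le> n\<close>) is the copy of \<open>H(1, 1, r i)\<close> whose vertical diagonal, of length
  \<open>r i + 1\<close>, lies on \<open>x = 0\<close> directly above those of the first \<open>i - 1\<close> cells.
\<close>

definition cell :: "(nat \<Rightarrow> nat) \<Rightarrow> nat \<Rightarrow> region" where
  "cell r i = hexagon (0, 2 * int (\<Sum>j\<in>{1..<i}. r j + 1)) 1 1 (r i)"

definition block_diag_symmetric_tilings ::
    "nat \<Rightarrow> nat \<Rightarrow> (nat \<Rightarrow> nat) \<Rightarrow> region set set" where
  "block_diag_symmetric_tilings m n r =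
     {\<tau>. lozenge_tiling (hexagon (0, 0) m m n) \<tau> \<and> symmetric_tiling \<tau> \<and>
         (\<forall>i\<in>{1..n}. card {L \<in> \<tau>. horizontal L \<and> L \<subseteq> cell r i} = r i)}"

text \<open>
  A lozenge is to the left of the diagonal if it does not cross it; a side of it may lie on the
  diagonal (the case \<open>k = 0\<close> of the weight \<open>q\<^sup>k t\<close>).
\<close>

definition left_of_diagonal :: "region \<Rightarrow> bool" where
  "left_of_diagonal L \<longleftrightarrow> (\<forall>v\<in>\<Union>L. fst v \<le> 0)"

text \<open>
  The right vertical side of a negative lozenge lies in its rightmost column \<open>x = -k\<close>, which is
  at distance \<open>k \<cdot> \<surd>3/2\<close> from the diagonal.
\<close>

definition lozenge_weight :: "'a::field \<Rightarrow> 'a \<Rightarrow> region \<Rightarrow> 'a" where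
  "lozenge_weight q t L =
     (if negative L then q ^ nat (- Max (fst ` \<Union>L)) * t else 1)"

definition tiling_weight :: "'a::field \<Rightarrow> 'a \<Rightarrow> region set \<Rightarrow> 'a" where
  "tiling_weight q t \<tau> = (\<Prod>L | L \<in> \<tau> \<and> left_of_diagonal L. lozenge_weight q t L)"

definition M_qt :: "'a::field \<Rightarrow> 'a \<Rightarrow> nat \<Rightarrow> nat \<Rightarrow> (nat \<Rightarrow> nat) \<Rightarrow> 'a" where
  "M_qt q t m n r = (\<Sum>\<tau>\<in>block_diag_symmetric_tilings m n r. tiling_weight q t \<tau>)"

definition qint :: "'a::field \<Rightarrow> nat \<Rightarrow> 'a" where
  "qint q k = (1 - q ^ k) / (1 - q)"

definition qfact :: "'a::field \<Rightarrow> nat \<Rightarrow> 'a" where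
  "qfact q k = (\<Prod>i=1..k. qint q i)"

text \<open>The sums and products above range over finite sets.\<close>

lemma finite_hexagon: "finite (hexagon p a b c)"
proof -
  let ?B = "{fst p - int b..fst p + int a} \<times> {snd p - int b..snd p + 2 * (int a + int b + int c)}"
  have "hexagon p a b c \<subseteq> Pow ?B"
  proof
    fix T assume T: "T \<in> hexagon p a b c"
    have "v \<in> ?B" if "v \<in> T" for v
      using T that by (cases v) (fastforce simp: hexagon_def Let_def)
    then show "T \<in> Pow ?B" by blast
  qed
  then show ?thesis by (rule finite_subset) simp
qed

lemma finite_block_diag_symmetric_tilings: "finite (block_diag_symmetric_tilings m n r)"
proof (rule finite_subset)
  show "block_diag_symmetric_tilings m n r \<subseteq> Pow (Pow (hexagon (0, 0) m m n))"
    by (auto simp: block_diag_symmetric_tilings_def lozenge_tiling_def partition_on_def)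
qed (simp add: finite_hexagon)

end

theory Submission
  imports Defs "Jordan_Normal_Form.Determinant" "HOL-Computational_Algebra.Polynomial_Factorial"
begin

text \<open>
  By symmetry a tiling is determined by its left half. The positive and negative lozenges there form
  \<open>n\<close> non-intersecting lattice paths that cross the columns between the left side and \<open>\<ell>\<close>, and
  the vertical diagonal of each cell contains the end of exactly one path. Peeling off one strip at
  a time, the weighted number of path families with end set \<open>A\<close> is
  \<open>t\<^sup>d \<Delta>(D) / \<Delta>({0, \<dots>, m - 1})\<close>, where \<open>D\<close> is the complement of \<open>A\<close>, \<open>d\<close> is the number of
  down-steps and \<open>\<Delta>(D)\<close> is the Vandermonde product of the numbers \<open>q\<^sup>a\<close> with \<open>a \<in> D\<close>; up to
  normalisation this is the principal specialisation of a Schur function. Summing over the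
  end point in each cell is a Pieri rule: it lets each element of
  \<open>D\<close>, starting from the position where every path ends at the top of its cell, stay or move up by
  one, and this multiplies the determinant \<open>\<Delta>(D)\<close> by \<open>\<Prod>j<m. 1 + t q\<^sup>j\<close>. Both steps
  are expansions of determinants along their rows in which all inadmissible terms vanish.
\<close>

section \<open>Vandermonde products\<close>

text \<open>Paths and holes call for different descriptions. One strip is summed over the set
  \<open>A\<close> of the \<open>n\<close> path positions, whose number stays fixed while each
  column gains an edge. The choice of end points is summed over the \<open>m\<close> holes
  \<open>D\<close>: lowering an end point by one costs one more down-step, hence a factor
  \<open>t\<close>, and lifts one hole. \<open>vand_complement\<close> translates between the two
  sides, and its products of distances are the source of the q-factorials in the denominator. The
  weight of a down-step refers to the distance from the diagonal, whereas the induction starts at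
  the left side; so the induction hypothesis carries a weight per down-step that loses one factor
  \<open>q\<close> with every column. The identities are stated as products without quotients, since
  Vandermonde products of powers of \<open>q\<close> can vanish.\<close>

definition vand :: "nat set \<Rightarrow> (nat \<Rightarrow> 'a::comm_ring_1) \<Rightarrow> 'a" where
  "vand A y = (\<Prod>b\<in>A. \<Prod>a\<in>{a\<in>A. a < b}. y b - y a)"

text \<open>Evaluation is a matrix product: the Vandermonde matrix times the matrix of coefficients,
  which the degree bound makes upper triangular.\<close>

lemma det_poly_columns:
  fixes y :: "nat \<Rightarrow> 'a::idom" and p :: "nat \<Rightarrow> 'a poly"
  assumes deg: "\<And>j. j < n \<Longrightarrow> degree (p j) \<le> j"
  shows "det (mat n n (\<lambda>(i, j). poly (p j) (y i))) =
    (\<Prod>j<n. coeff (p j) j) * det (mat n n (\<lambda>(i, j). y i ^ j))"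
proof -
  let ?C = "mat n n (\<lambda>(i, j). coeff (p j) i)"
  let ?Y = "mat n n (\<lambda>(i, j). y i ^ j)"
  have "mat n n (\<lambda>(i, j). poly (p j) (y i)) = ?Y * ?C"
  proof (rule eq_matI)
    fix i j assume "i < dim_row (?Y * ?C)" "j < dim_col (?Y * ?C)"
    then have ij: "i < n" "j < n" by auto
    have "poly (p j) (y i) = (\<Sum>k\<le>degree (p j). coeff (p j) k * y i ^ k)"
      by (rule poly_altdef)
    also have "\<dots> = (\<Sum>k<n. coeff (p j) k * y i ^ k)"
      using deg[OF ij(2)] ij
      by (intro sum.mono_neutral_left) (auto simp: not_le coeff_eq_0)
    finally show "mat n n (\<lambda>(i, j). poly (p j) (y i)) $$ (i, j) = (?Y * ?C) $$ (i, j)"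
      using ij by (simp add: scalar_prod_def atLeast0LessThan mult.commute)
  qed auto
  then have "det (mat n n (\<lambda>(i, j). poly (p j) (y i))) = det ?Y * det ?C"
    by (simp add: det_mult[of _ n])
  moreover have "det ?C = prod_list (diag_mat ?C)"
    by (rule det_upper_triangular[of _ n])
      (auto simp: upper_triangular_def intro!: coeff_eq_0 order.strict_trans1[OF deg])
  moreover have "prod_list (diag_mat ?C) = (\<Prod>j<n. coeff (p j) j)"
    by (simp add: prod_list_diag_prod atLeast0LessThan)
  ultimately show ?thesis by (simp add: mult.commute)
qed

text \<open>In the Newton basis, whose \<open>j\<close>-th member is monic with the roots
  \<open>y k\<close> for \<open>k < j\<close>, the matrix of values is lower triangular, and its
  diagonal entries are the inner products of \<open>vand\<close>.\<close>

lemma det_vandermonde: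
  fixes y :: "nat \<Rightarrow> 'a::idom"
  shows "det (mat n n (\<lambda>(i, j). y i ^ j)) = vand {..<n} y"
proof -
  let ?p = "\<lambda>j. \<Prod>k<j. [:- y k, 1:]"
  have deg: "degree (?p j) = j" for j
    by (simp add: degree_prod_eq_sum_degree)
  have lead: "coeff (?p j) j = 1" for j
    using lead_coeff_prod[of "\<lambda>k. [:- y k, 1:]" "{..<j}"] by (simp only: deg) simp
  let ?N = "mat n n (\<lambda>(i, j). poly (?p j) (y i))"
  have "det ?N = det (mat n n (\<lambda>(i, j). y i ^ j))"
    by (subst det_poly_columns) (simp_all only: deg lead order.refl prod.neutral_const mult_1_left)
  moreover have "det ?N = prod_list (diag_mat ?N)"
    by (rule det_lower_triangular[of n]) (auto simp: poly_prod)
  moreover have "prod_list (diag_mat ?N) = vand {..<n} y"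
    by (auto simp: prod_list_diag_prod vand_def poly_prod atLeast0LessThan intro!: prod.cong)
  ultimately show ?thesis by simp
qed

section \<open>Expansion of determinants over subsets of rows\<close>

lemma det_rows_add:
  fixes f g :: "nat \<Rightarrow> nat \<Rightarrow> 'a::comm_ring_1"
  shows "det (mat n n (\<lambda>(i, j). f i j + g i j)) =
    (\<Sum>U\<in>Pow {..<n}. det (mat n n (\<lambda>(i, j). if i \<in> U then f i j else g i j)))"
proof -
  have "det (mat n n (\<lambda>(i, j). f i j + g i j)) =
    (\<Sum>p | p permutes {0..<n}. signof p * (\<Prod>i = 0..<n. f i (p i) + g i (p i)))"
    by (auto simp: det_def permutes_in_image intro!: sum.cong prod.cong)
  also have "\<dots> = (\<Sum>p | p permutes {0..<n}. signof p * (\<Sum>U\<in>Pow {..<n}.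
      \<Prod>i = 0..<n. if i \<in> U then f i (p i) else g i (p i)))"
    by (subst prod_add, simp)
      (auto simp: atLeast0LessThan prod.If_cases Int_absorb1 Int_Diff Diff_eq
        intro!: sum.cong arg_cong2[of _ _ _ _ "(*)"] prod.cong)
  also have "\<dots> = (\<Sum>U\<in>Pow {..<n}. \<Sum>p | p permutes {0..<n}. signof p * (
      \<Prod>i = 0..<n. if i \<in> U then f i (p i) else g i (p i)))"
    unfolding sum_distrib_left by (rule sum.swap)
  also have "\<dots> = (\<Sum>U\<in>Pow {..<n}. det (mat n n (\<lambda>(i, j). if i \<in> U then f i j else g i j)))"
    by (auto simp: det_def permutes_in_image intro!: sum.cong prod.cong)
  finally show ?thesis .
qed

lemma det_scale_rows:
  fixes f :: "nat \<Rightarrow> nat \<Rightarrow> 'a::comm_ring_1"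
  shows "det (mat n n (\<lambda>(i, j). c i * f i j)) = (\<Prod>i<n. c i) * det (mat n n (\<lambda>(i, j). f i j))"
proof -
  have "det (mat n n (\<lambda>(i, j). c i * f i j)) =
    (\<Sum>p | p permutes {0..<n}. signof p * (\<Prod>i = 0..<n. c i * f i (p i)))"
    by (auto simp: det_def permutes_in_image intro!: sum.cong prod.cong)
  also have "\<dots> = (\<Prod>i<n. c i) * (\<Sum>p | p permutes {0..<n}. signof p * (\<Prod>i = 0..<n. f i (p i)))"
    by (simp add: prod.distrib sum_distrib_left atLeast0LessThan ac_simps)
  also have "(\<Sum>p | p permutes {0..<n}. signof p * (\<Prod>i = 0..<n. f i (p i))) =
      det (mat n n (\<lambda>(i, j). f i j))"
    by (auto simp: det_def permutes_in_image intro!: sum.cong prod.cong)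
  finally show ?thesis .
qed

lemma sum_vand_subsets_lessThan:
  fixes g0 g1 z0 z1 :: "nat \<Rightarrow> 'a::idom"
  shows "(\<Sum>U\<in>Pow {..<n}. (\<Prod>i\<in>{..<n} - U. g0 i) * (\<Prod>i\<in>U. g1 i) *
      vand {..<n} (\<lambda>i. if i \<in> U then z1 i else z0 i)) =
    det (mat n n (\<lambda>(i, j). g1 i * z1 i ^ j + g0 i * z0 i ^ j))"
proof -
  have "(\<Prod>i\<in>{..<n} - U. g0 i) * (\<Prod>i\<in>U. g1 i) *
      vand {..<n} (\<lambda>i. if i \<in> U then z1 i else z0 i) =
      det (mat n n (\<lambda>(i, j). if i \<in> U then g1 i * z1 i ^ j else g0 i * z0 i ^ j))"
    if "U \<subseteq> {..<n}" for U
  proof -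
    have "(\<Prod>i\<in>{..<n} - U. g0 i) * (\<Prod>i\<in>U. g1 i) = (\<Prod>i<n. if i \<in> U then g1 i else g0 i)"
      using that by (simp add: prod.If_cases Int_absorb1 Diff_eq mult.commute)
    then show ?thesis
      unfolding det_vandermonde[symmetric] det_scale_rows[symmetric]
      by (simp add: det_scale_rows[symmetric])
        (rule arg_cong[of _ _ det], auto)
  qed
  then show ?thesis unfolding det_rows_add by (intro sum.cong) auto
qed

text \<open>The order of the indices fixes the sign of each factor of \<open>vand\<close>, so only
  an increasing reindexing is harmless.\<close>

lemma vand_reindex:
  assumes "strict_mono_on B e"
  shows "vand (e ` B) y = vand B (y \<circ> e)"
proof -
  have inj: "inj_on e B" using assms by (rule strict_mono_on_imp_inj_on)
  have "{a \<in> e ` B. a < e b} = e ` {a \<in> B. a < b}" if "b \<in> B" for b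
    using that assms by (auto simp: strict_mono_on_less)
  moreover have "inj_on e {a \<in> B. a < b}" for b
    using inj by (rule inj_on_subset) auto
  ultimately show ?thesis
    using inj by (simp add: vand_def prod.reindex)
qed

text \<open>
  Each choice \<open>U\<close> of the rows that use the summand \<open>g1 z1\<^sup>j\<close> contributes a Vandermonde determinant.
\<close>

lemma sum_vand_subsets:
  fixes g0 g1 z0 z1 y :: "nat \<Rightarrow> 'a::idom"
  assumes "finite A" "card A = n"
  obtains e where "bij_betw e {..<n} A"
    and "(\<Sum>U\<in>Pow A. (\<Prod>a\<in>A - U. g0 a) * (\<Prod>a\<in>U. g1 a) *
      vand A (\<lambda>a. if a \<in> U then z1 a else z0 a)) =
    det (mat n n (\<lambda>(i, j). g1 (e i) * z1 (e i) ^ j + g0 (e i) * z0 (e i) ^ j))"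
    and "vand A y = det (mat n n (\<lambda>(i, j). y (e i) ^ j))"
proof -
  \<comment> \<open>The increasing enumeration, so that \<open>vand A\<close> becomes a determinant
    with the correct sign.\<close>
  define e where "e = (\<lambda>i. sorted_list_of_set A ! i)"
  have mono: "strict_mono_on {..<n} e"
    using assms strict_sorted_list_of_set[of A]
    by (auto simp: strict_mono_on_def e_def sorted_wrt_iff_nth_less)
  have bij: "bij_betw e {..<n} A"
    unfolding e_def using assms by (intro bij_betw_nth) auto
  then have inj: "inj_on e {..<n}" and A: "A = e ` {..<n}"
    by (auto simp: bij_betw_def)
  have vA: "vand A f = vand {..<n} (f \<circ> e)" for f :: "nat \<Rightarrow> 'a"
    unfolding A by (rule vand_reindex[OF mono])
  have "(\<Sum>U\<in>Pow A. (\<Prod>a\<in>A - U. g0 a) * (\<Prod>a\<in>U. g1 a) *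
      vand A (\<lambda>a. if a \<in> U then z1 a else z0 a)) =
    (\<Sum>U\<in>Pow {..<n}. (\<Prod>a\<in>A - e ` U. g0 a) * (\<Prod>a\<in>e ` U. g1 a) *
      vand A (\<lambda>a. if a \<in> e ` U then z1 a else z0 a))"
    unfolding A image_Pow_surj[OF refl, symmetric]
    by (subst sum.reindex) (auto simp: inj_on_image_Pow[OF inj])
  also have "\<dots> = (\<Sum>U\<in>Pow {..<n}. (\<Prod>i\<in>{..<n} - U. g0 (e i)) * (\<Prod>i\<in>U. g1 (e i)) *
      vand {..<n} (\<lambda>i. if i \<in> U then z1 (e i) else z0 (e i)))"
  proof (rule sum.cong[OF refl])
    fix U assume "U \<in> Pow {..<n}"
    then have U: "U \<subseteq> {..<n}" by simp
    have "A - e ` U = e ` ({..<n} - U)"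
      unfolding A using inj U by (simp add: inj_on_image_set_diff)
    moreover have "inj_on e U" "inj_on e ({..<n} - U)"
      using inj U by (auto intro: inj_on_subset)
    moreover have "e i \<in> e ` U \<longleftrightarrow> i \<in> U" if "i < n" for i
      using inj U that by (auto dest: inj_onD)
    then have "vand {..<n} ((\<lambda>a. if a \<in> e ` U then z1 a else z0 a) \<circ> e) =
      vand {..<n} (\<lambda>i. if i \<in> U then z1 (e i) else z0 (e i))"
      by (auto simp: vand_def intro!: prod.cong)
    ultimately show "(\<Prod>a\<in>A - e ` U. g0 a) * (\<Prod>a\<in>e ` U. g1 a) *
      vand A (\<lambda>a. if a \<in> e ` U then z1 a else z0 a) =
      (\<Prod>i\<in>{..<n} - U. g0 (e i)) * (\<Prod>i\<in>U. g1 (e i)) *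
      vand {..<n} (\<lambda>i. if i \<in> U then z1 (e i) else z0 (e i))"
      by (simp add: vA prod.reindex)
  qed
  also note sum_vand_subsets_lessThan
  finally show thesis
    using bij that vA[of y] by (simp add: det_vandermonde[symmetric] o_def)
qed

text \<open>Replacing \<open>y\<close> by \<open>q * y\<close> multiplies \<open>y ^ j\<close> by
  \<open>q ^ j\<close>, so the sum of the two alternatives in a row is \<open>y ^ j\<close> times a
  factor that depends on the column only.\<close>

lemma pieri_vand:
  fixes y :: "nat \<Rightarrow> 'a::idom"
  assumes "finite A" "card A = n"
  shows "(\<Sum>U\<in>Pow A. t ^ card U * vand A (\<lambda>a. if a \<in> U then q * y a else y a)) =
    (\<Prod>j<n. 1 + t * q ^ j) * vand A y"
proof -
  obtain e where e: "(\<Sum>U\<in>Pow A. (\<Prod>a\<in>A - U. 1) * (\<Prod>a\<in>U. t) *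
      vand A (\<lambda>a. if a \<in> U then q * y a else y a)) =
    det (mat n n (\<lambda>(i, j). t * (q * y (e i)) ^ j + 1 * y (e i) ^ j))"
    "vand A y = det (mat n n (\<lambda>(i, j). y (e i) ^ j))"
    by (rule sum_vand_subsets[OF assms, of "\<lambda>_. 1" "\<lambda>_. t" "\<lambda>a. q * y a" y y])
  have "mat n n (\<lambda>(i, j). t * (q * y (e i)) ^ j + 1 * y (e i) ^ j) =
      mat n n (\<lambda>(i, j). poly (monom (1 + t * q ^ j) j) (y (e i)))"
    by (rule eq_matI) (auto simp: poly_monom algebra_simps)
  then show ?thesis using e
    by (simp add: det_poly_columns[of n "\<lambda>j. monom (1 + t * q ^ j) j"] degree_monom_le)
qed

text \<open>
  The matrix entries are \<open>y * (Q * (q\<^sup>j - 1) * y\<^sup>j\<^sup>-\<^sup>1 + (Q - q\<^sup>j) * y\<^sup>j)\<close>: the polynomial in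
  brackets has degree \<open>j\<close>, also for \<open>j = 0\<close>.
\<close>

lemma branching_vand:
  fixes y :: "nat \<Rightarrow> 'a::idom"
  assumes "finite A" "card A = n"
  shows "(\<Sum>U\<in>Pow A. (\<Prod>a\<in>A - U. Q - y a) * (\<Prod>a\<in>U. (y a - 1) * Q) *
      vand A (\<lambda>a. if a \<in> U then y a else q * y a)) =
    (\<Prod>j<n. Q - q ^ j) * (\<Prod>a\<in>A. y a) * vand A y"
proof -
  obtain e where e: "bij_betw e {..<n} A" "(\<Sum>U\<in>Pow A. (\<Prod>a\<in>A - U. Q - y a) *
      (\<Prod>a\<in>U. (y a - 1) * Q) * vand A (\<lambda>a. if a \<in> U then y a else q * y a)) =
    det (mat n n (\<lambda>(i, j). (y (e i) - 1) * Q * y (e i) ^ j + (Q - y (e i)) * (q * y (e i)) ^ j))"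
    "vand A y = det (mat n n (\<lambda>(i, j). y (e i) ^ j))"
    by (rule sum_vand_subsets[OF assms, of "\<lambda>a. Q - y a" "\<lambda>a. (y a - 1) * Q" y "\<lambda>a. q * y a" y])
  \<comment> \<open>For \<open>j = 0\<close> the second coefficient is zero, so the truncated
    exponent \<open>j - 1\<close> does no harm.\<close>
  define p where "p = (\<lambda>j. monom (Q - q ^ j) j + monom (Q * (q ^ j - 1)) (j - 1))"
  have deg: "degree (p j) \<le> j" for j
    unfolding p_def by (intro degree_add_le order.trans[OF degree_monom_le]) auto
  have lead: "coeff (p j) j = Q - q ^ j" for j
    by (cases j) (auto simp: p_def)
  have "mat n n (\<lambda>(i, j). (y (e i) - 1) * Q * y (e i) ^ j + (Q - y (e i)) * (q * y (e i)) ^ j) =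
      mat n n (\<lambda>(i, j). y (e i) * poly (p j) (y (e i)))"
  proof (rule eq_matI)
    show "mat n n (\<lambda>(i, j). (y (e i) - 1) * Q * y (e i) ^ j + (Q - y (e i)) * (q * y (e i)) ^ j) $$ (i, j)
        = mat n n (\<lambda>(i, j). y (e i) * poly (p j) (y (e i))) $$ (i, j)"
      if "i < dim_row (mat n n (\<lambda>(i, j). y (e i) * poly (p j) (y (e i))))"
        "j < dim_col (mat n n (\<lambda>(i, j). y (e i) * poly (p j) (y (e i))))" for i j
      using that by (cases j) (auto simp: p_def poly_monom algebra_simps)
  qed auto
  then show ?thesis
    using e by (simp add: det_scale_rows det_poly_columns[OF deg] lead prod.reindex_bij_betw)
qed

section \<open>Non-intersecting paths\<close>

lemma prod_const_vand:
  fixes c :: "'a::comm_ring_1"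
  assumes "finite A"
  shows "vand A (\<lambda>a. c * y a) = c ^ (card A choose 2) * vand A y"
  using assms
proof (induction rule: finite_linorder_max_induct)
  case empty
  then show ?case by (simp add: vand_def numeral_2_eq_2)
next
  case (insert b A)
  have *: "vand (insert b A) f = (\<Prod>a\<in>A. f b - f a) * vand A f" for f :: "nat \<Rightarrow> 'a"
  proof -
    have "{a \<in> insert b A. a < b} = A" using insert.hyps by auto
    moreover have "{a \<in> insert b A. a < x} = {a \<in> A. a < x}" if "x \<in> A" for x
      using insert.hyps that by force
    ultimately show ?thesis
      using insert.hyps by (simp add: vand_def) (subst prod.insert, auto)
  qed
  have "b \<notin> A" using insert.hyps by auto
  moreover have "Suc k choose 2 = k + (k choose 2)" for k
    by (simp add: numeral_2_eq_2)
  moreover have "(\<Prod>a\<in>A. c * y b - c * y a) = c ^ card A * (\<Prod>a\<in>A. y b - y a)"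
    by (simp add: right_diff_distrib[symmetric] prod.distrib)
  ultimately show ?case
    using insert by (simp add: * power_add)
qed

text \<open>Larger exponent first: the distance is symmetric, and products over ordered pairs need
  no signs.\<close>

definition qdist :: "'a::comm_ring_1 \<Rightarrow> nat \<Rightarrow> nat \<Rightarrow> 'a" where
  "qdist q a b = q ^ max a b - q ^ min a b"

text \<open>For \<open>a < N\<close> this is, up to sign, the derivative at \<open>q ^ a\<close> of
  the monic polynomial with the roots \<open>q ^ b\<close>, \<open>b < N\<close>.\<close>

definition qdists :: "'a::comm_ring_1 \<Rightarrow> nat \<Rightarrow> nat \<Rightarrow> 'a" where
  "qdists q N a = (\<Prod>b\<in>{..<N} - {a}. qdist q a b)"

section \<open>Vandermonde products of complementary sets of exponents\<close>

lemma vand_insert: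
  assumes "finite A" "x \<notin> A"
  shows "vand (insert x A) ((^) q) = vand A ((^) q) * (\<Prod>a\<in>A. qdist q x a)"
proof -
  have "vand (insert x A) ((^) q) =
      (\<Prod>b\<in>A. \<Prod>a\<in>{a\<in>insert x A. a < b}. q ^ b - q ^ a) * (\<Prod>a\<in>{a\<in>A. a < x}. q ^ x - q ^ a)"
    using assms by (simp add: vand_def mult.commute)
      (intro arg_cong2[of _ _ _ _ "(*)"] prod.cong, auto)
  also have "(\<Prod>b\<in>A. \<Prod>a\<in>{a\<in>insert x A. a < b}. q ^ b - q ^ a) =
      (\<Prod>b\<in>A. (\<Prod>a\<in>{a\<in>A. a < b}. q ^ b - q ^ a) * (if x < b then q ^ b - q ^ x else 1))"
  proof (rule prod.cong[OF refl])
    fix b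
    have "{a \<in> insert x A. a < b} = (if x < b then insert x {a\<in>A. a < b} else {a\<in>A. a < b})"
      by auto
    then show "(\<Prod>a\<in>{a\<in>insert x A. a < b}. q ^ b - q ^ a) =
      (\<Prod>a\<in>{a\<in>A. a < b}. q ^ b - q ^ a) * (if x < b then q ^ b - q ^ x else 1)"
      using assms by (simp add: mult.commute)
  qed
  also have "\<dots> = vand A ((^) q) * (\<Prod>b\<in>A. if x < b then q ^ b - q ^ x else 1)"
    by (simp add: prod.distrib vand_def)
  also have "(\<Prod>a\<in>{a\<in>A. a < x}. q ^ x - q ^ a) = (\<Prod>a\<in>A. if a < x then q ^ x - q ^ a else 1)"
    using assms by (intro prod.mono_neutral_cong_left) auto
  finally show ?thesis
    using assms by (simp add: mult.assoc prod.distrib[symmetric])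
      (intro arg_cong2[of _ _ _ _ "(*)"] prod.cong, auto simp: qdist_def max_def min_def)
qed

lemma vand_Un:
  assumes "finite A" "finite D" "A \<inter> D = {}"
  shows "vand (A \<union> D) ((^) q) =
    vand A ((^) q) * vand D ((^) q) * (\<Prod>a\<in>A. \<Prod>d\<in>D. qdist q a d)"
  using assms
proof (induction rule: finite_induct)
  case empty
  then show ?case by (simp add: vand_def)
next
  case (insert x A)
  then show ?case
    by (simp add: vand_insert prod.union_disjoint mult_ac)
qed

lemma prod_qdist_eq_vand_square:
  assumes "finite A"
  shows "(\<Prod>a\<in>A. \<Prod>b\<in>A - {a}. qdist q a b) = vand A ((^) q) ^ 2"
  using assms
proof (induction rule: finite_induct)
  case empty
  then show ?case by (simp add: vand_def)
next
  case (insert x A)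
  have "(\<Prod>a\<in>A. \<Prod>b\<in>insert x A - {a}. qdist q a b) =
      (\<Prod>a\<in>A. qdist q x a * (\<Prod>b\<in>A - {a}. qdist q a b))"
  proof (rule prod.cong[OF refl])
    fix a assume "a \<in> A"
    then have "insert x A - {a} = insert x (A - {a})" using insert.hyps by auto
    then show "(\<Prod>b\<in>insert x A - {a}. qdist q a b) = qdist q x a * (\<Prod>b\<in>A - {a}. qdist q a b)"
      using insert.hyps by (simp add: qdist_def max.commute min.commute)
  qed
  then show ?case
    using insert by (simp add: vand_insert prod.distrib power2_eq_square mult_ac)
qed

text \<open>Let \<open>D\<close> be the complement and \<open>X\<close> the product of all distances
  between \<open>A\<close> and \<open>D\<close>. Then \<open>vand {..<N}\<close> is the product of
  \<open>vand A\<close>, \<open>vand D\<close> and \<open>X\<close>, while the product of the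
  \<open>qdists\<close> is the square of \<open>vand A\<close> times \<open>X\<close>: it meets each
  pair inside \<open>A\<close> twice and each mixed pair once.\<close>

lemma vand_complement:
  assumes "A \<subseteq> {..<N}"
  shows "vand {..<N} ((^) q) * vand A ((^) q) = vand ({..<N} - A) ((^) q) * (\<Prod>a\<in>A. qdists q N a)"
proof -
  let ?D = "{..<N} - A"
  have fin: "finite A" using assms finite_subset by blast
  have "(\<Prod>a\<in>A. qdists q N a) =
      (\<Prod>a\<in>A. (\<Prod>b\<in>A - {a}. qdist q a b) * (\<Prod>d\<in>?D. qdist q a d))"
  proof (rule prod.cong[OF refl])
    fix a assume "a \<in> A"
    then have "{..<N} - {a} = (A - {a}) \<union> ?D" using assms by auto
    then show "qdists q N a = (\<Prod>b\<in>A - {a}. qdist q a b) * (\<Prod>d\<in>?D. qdist q a d)"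
      unfolding qdists_def using fin by (simp only:) (subst prod.union_disjoint, auto)
  qed
  also have "\<dots> = vand A ((^) q) ^ 2 * (\<Prod>a\<in>A. \<Prod>d\<in>?D. qdist q a d)"
    using fin by (simp add: prod.distrib prod_qdist_eq_vand_square)
  finally have w: "(\<Prod>a\<in>A. qdists q N a) =
      vand A ((^) q) ^ 2 * (\<Prod>a\<in>A. \<Prod>d\<in>?D. qdist q a d)" .
  have "vand {..<N} ((^) q) = vand (A \<union> ?D) ((^) q)"
    using assms by (simp add: Un_absorb1)
  also have "\<dots> = vand A ((^) q) * vand ?D ((^) q) * (\<Prod>a\<in>A. \<Prod>d\<in>?D. qdist q a d)"
    using fin by (intro vand_Un) auto
  finally show ?thesis
    by (simp add: w power2_eq_square mult_ac)
qed

lemma vand_lessThan_Suc: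
  "vand {..<Suc N} ((^) q) = vand {..<N} ((^) q) * (\<Prod>b<N. q ^ N - q ^ b)"
  by (auto simp: lessThan_Suc vand_insert qdist_def max_def min_def intro!: prod.cong)

lemma qdists_Suc_same:
  assumes "a < N"
  shows "qdists q (Suc N) a = qdists q N a * (q ^ N - q ^ a)"
proof -
  have "{..<Suc N} - {a} = insert N ({..<N} - {a})" using assms by auto
  then show ?thesis
    using assms by (simp add: qdists_def qdist_def max_def min_def mult.commute)
qed

text \<open>Apart from 0, the positions other than \<open>Suc a\<close> are the successors of those
  other than \<open>a\<close>. Each of these \<open>N - 1\<close> distances gains a factor
  \<open>q\<close>, and the extra factor on the left completes \<open>q ^ N\<close>.\<close>

lemma qdists_Suc_Suc:
  assumes "a < N"
  shows "q * qdists q (Suc N) (Suc a) = qdists q N a * ((q ^ Suc a - 1) * q ^ N)"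
proof -
  have "{..<Suc N} - {Suc a} = insert 0 (Suc ` ({..<N} - {a}))"
  proof (intro subset_antisym subsetI)
    fix x assume "x \<in> {..<Suc N} - {Suc a}"
    then show "x \<in> insert 0 (Suc ` ({..<N} - {a}))" by (cases x) auto
  qed auto
  moreover have "qdist q (Suc a) (Suc b) = q * qdist q a b" for b
    by (simp add: qdist_def right_diff_distrib)
  moreover have "qdist q (Suc a) 0 = q ^ Suc a - 1"
    by (simp add: qdist_def)
  ultimately have "q * qdists q (Suc N) (Suc a) =
      (q ^ Suc a - 1) * (q * q ^ card ({..<N} - {a})) * qdists q N a"
    by (simp add: qdists_def prod.reindex prod.distrib mult_ac del: card_Diff_insert)
  moreover have "q * q ^ card ({..<N} - {a}) = q ^ N"
    using assms by (cases N) auto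
  ultimately show ?thesis
    by (simp only:) (simp add: mult_ac)
qed

text \<open>The extreme case consists of the \<open>card A\<close> largest numbers below
  \<open>N\<close>. The bound guarantees that the subtraction in \<open>downs\<close> is not
  truncated.\<close>

lemma sum_le_top_sum:
  assumes "A \<subseteq> {..<N}"
  shows "\<Sum>A + (card A choose 2) + card A \<le> card A * N"
  using assms
proof (induction N arbitrary: A)
  case 0
  then show ?case by simp
next
  case (Suc N)
  have fin: "finite A" using Suc.prems finite_subset by blast
  show ?case
  proof (cases "N \<in> A")
    case True
    define B where "B = A - {N}"
    have A: "A = insert N B" "N \<notin> B" "finite B" using True fin by (auto simp: B_def)
    have "B \<subseteq> {..<N}" using Suc.prems by (auto simp: B_def less_Suc_eq)
    from Suc.IH[OF this] show ?thesis
      using A by (simp add: numeral_2_eq_2)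
  next
    case False
    then have "A \<subseteq> {..<N}" using Suc.prems by (auto simp: less_Suc_eq)
    from Suc.IH[OF this] show ?thesis by simp
  qed
qed

section \<open>Down-steps, and a single step of a path family\<close>

lemma choose_two_double: "2 * (n choose 2) + n = n * n"
  by (induction n) (auto simp: numeral_2_eq_2)

text \<open>
  The number of down-steps in \<open>n\<close> paths of \<open>c\<close> steps that start at \<open>0, \<dots>, n - 1\<close> and end in \<open>A\<close>.
\<close>

definition downs :: "nat \<Rightarrow> nat \<Rightarrow> nat set \<Rightarrow> nat" where
  "downs n c A = n * c + (n choose 2) - \<Sum>A"

text \<open>The starting positions add up to \<open>n choose 2\<close>, and each of the
  \<open>n * c\<close> steps adds one unless it is a down-step.\<close>

lemma downs_add_sum:
  assumes "A \<subseteq> {..<n + c}" "card A = n"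
  shows "downs n c A + \<Sum>A = n * c + (n choose 2)"
proof -
  have "\<Sum>A + (n choose 2) + n \<le> n * (n + c)"
    using sum_le_top_sum[OF assms(1)] assms(2) by simp
  then show ?thesis
    using choose_two_double[of n] by (simp add: downs_def algebra_simps)
qed

text \<open>
  \<open>A\<close> is the set of positions of the paths on a column with \<open>N + 1\<close> edges, \<open>U\<close> the set of those
  that were reached by an up-step; on the previous column the paths are at \<open>step_back A U\<close>.
  An up-step increases the position by one, and a down-step preserves it because the bottom edge of
  the next column is lower.
\<close>

definition step_back :: "nat set \<Rightarrow> nat set \<Rightarrow> nat set" where
  "step_back A U = (A - U) \<union> (\<lambda>a. a - 1) ` U"

definition valid_step :: "nat \<Rightarrow> nat set \<Rightarrow> nat set \<Rightarrow> bool" where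
  "valid_step N A U \<longleftrightarrow> U \<subseteq> A \<and> 0 \<notin> U \<and> N \<notin> A - U \<and> (A - U) \<inter> (\<lambda>a. a - 1) ` U = {}"

text \<open>The coefficients are those of \<open>branching_vand\<close> at \<open>Q = q ^ N\<close>
  and \<open>y a = q ^ a\<close>. A path that stepped down keeps its old distances and gains the one
  to the new top position \<open>N\<close>. A path that stepped up has its old distances multiplied
  by \<open>q\<close> and gains the one to position 0.\<close>

lemma
  assumes "valid_step N A U" "A \<subseteq> {..<Suc N}"
  shows step_back_subset: "step_back A U \<subseteq> {..<N}"
    and card_step_back: "card (step_back A U) = card A"
    and sum_step_back: "\<Sum>(step_back A U) + card U = \<Sum>A"
    and qdists_step_back: "q ^ card U * (\<Prod>a\<in>A. qdists q (Suc N) a) =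
      (\<Prod>a\<in>step_back A U. qdists q N a) *
      ((\<Prod>a\<in>A - U. q ^ N - q ^ a) * (\<Prod>a\<in>U. (q ^ a - 1) * q ^ N))"
    and vand_step_back: "q ^ (card A choose 2) * vand (step_back A U) ((^) q) =
      vand A (\<lambda>a. if a \<in> U then q ^ a else q * q ^ a)"
proof -
  have finA: "finite A" using assms finite_subset by blast
  have U: "U \<subseteq> A" "0 \<notin> U" "N \<notin> A - U" "(A - U) \<inter> (\<lambda>a. a - 1) ` U = {}"
    using assms by (auto simp: valid_step_def)
  have finU: "finite U" using U(1) finA finite_subset by blast
  have pos: "a > 0" if "a \<in> U" for a using U(2) that by (cases a) auto
  have inj: "inj_on (\<lambda>a. a - 1) U"
  proof (rule inj_onI)
    show "a = b" if "a \<in> U" "b \<in> U" "a - 1 = b - 1" for a b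
      using that pos[of a] pos[of b] by simp
  qed
  have A: "A = (A - U) \<union> U" using U(1) by auto
  show "step_back A U \<subseteq> {..<N}"
    using assms(2) U pos by (fastforce simp: step_back_def less_Suc_eq)
  have sumA: "\<Sum>A = \<Sum>(A - U) + \<Sum>U"
    using sum.subset_diff[OF U(1) finA] by simp
  have "card A = card (A - U) + card U"
    using card_Diff_subset[OF finU U(1)] card_mono[OF finA U(1)] by simp
  then show "card (step_back A U) = card A"
    unfolding step_back_def using finA finU U(4) inj by (simp add: card_Un_disjoint card_image)
  have "\<Sum>(step_back A U) = \<Sum>(A - U) + (\<Sum>a\<in>U. a - 1)"
    unfolding step_back_def using finA finU U(4) inj
    by (simp add: sum.union_disjoint sum.reindex)
  moreover have "(\<Sum>a\<in>U. a - 1) + card U = \<Sum>U"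
    using pos by (simp add: card_eq_sum sum.distrib[symmetric] del: One_nat_def sum_constant)
      (rule sum.cong, auto)
  ultimately show "\<Sum>(step_back A U) + card U = \<Sum>A"
    by (simp add: sumA)
  have up: "q * qdists q (Suc N) a = qdists q N (a - 1) * ((q ^ a - 1) * q ^ N)" if "a \<in> U" for a
    using qdists_Suc_Suc[of "a - 1" N q] pos[OF that] that U(1) assms(2) by fastforce
  have down: "qdists q (Suc N) a = qdists q N a * (q ^ N - q ^ a)" if "a \<in> A - U" for a
    using that U(3) assms(2) by (intro qdists_Suc_same) (auto simp: less_Suc_eq)
  have "q ^ card U * (\<Prod>a\<in>A. qdists q (Suc N) a) =
      (\<Prod>a\<in>A - U. qdists q (Suc N) a) * (\<Prod>a\<in>U. q * qdists q (Suc N) a)"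
    by (subst A, subst prod.union_disjoint) (use finA finU in \<open>auto simp: prod.distrib mult_ac\<close>)
  also have "\<dots> = (\<Prod>a\<in>A - U. qdists q N a * (q ^ N - q ^ a)) *
      (\<Prod>a\<in>U. qdists q N (a - 1) * ((q ^ a - 1) * q ^ N))"
    by (simp only: prod.cong[OF refl up] prod.cong[OF refl down])
  also have "\<dots> = (\<Prod>a\<in>step_back A U. qdists q N a) *
      ((\<Prod>a\<in>A - U. q ^ N - q ^ a) * (\<Prod>a\<in>U. (q ^ a - 1) * q ^ N))"
    unfolding step_back_def using finA finU U(4) inj
    by (simp add: prod.union_disjoint prod.reindex prod.distrib mult_ac)
  finally show "q ^ card U * (\<Prod>a\<in>A. qdists q (Suc N) a) =
      (\<Prod>a\<in>step_back A U. qdists q N a) *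
      ((\<Prod>a\<in>A - U. q ^ N - q ^ a) * (\<Prod>a\<in>U. (q ^ a - 1) * q ^ N))" .
  \<comment> \<open>The previous position of each path. Order could only be lost if two neighbouring
    paths came from the same position, which validity excludes. The additional factor
    \<open>q\<close> introduced below turns the value \<open>q ^ (a - 1)\<close> of an up-step into
    \<open>q ^ a\<close>.\<close>
  define z where "z = (\<lambda>a. if a \<in> U then a - 1 else a)"
  have mono: "strict_mono_on A z"
  proof (rule strict_mono_onI)
    fix a b assume ab: "a \<in> A" "b \<in> A" "a < b"
    have "\<not> (a \<notin> U \<and> b \<in> U \<and> b - 1 = a)" using U(4) ab by blast
    then show "z a < z b"
      using ab pos[of a] pos[of b] by (auto simp: z_def)
  qed
  have "z ` A = step_back A U" by (subst A) (auto simp: z_def step_back_def image_Un)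
  then have "vand (step_back A U) ((^) q) = vand A (\<lambda>a. q ^ z a)"
    using vand_reindex[OF mono, of "(^) q"] by (simp add: o_def)
  then have "q ^ (card A choose 2) * vand (step_back A U) ((^) q) = vand A (\<lambda>a. q * q ^ z a)"
    by (simp add: prod_const_vand[OF finA])
  also have "(\<lambda>a. q * q ^ z a) = (\<lambda>a. if a \<in> U then q ^ a else q * q ^ a)"
  proof
    show "q * q ^ z a = (if a \<in> U then q ^ a else q * q ^ a)" for a
      using pos[of a] by (cases a) (auto simp: z_def)
  qed
  finally show "q ^ (card A choose 2) * vand (step_back A U) ((^) q) =
      vand A (\<lambda>a. if a \<in> U then q ^ a else q * q ^ a)" .
qed

text \<open>Each defect has its own vanishing factor: an up-step into position 0 gives
  \<open>q ^ 0 - 1\<close>, a down-step into the top position gives \<open>q ^ N - q ^ N\<close>,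
  and two paths from the same position give two equal entries of the Vandermonde product.\<close>

lemma invalid_step_vanishes:
  fixes q :: "'a::idom"
  assumes "\<not> valid_step N A U" "U \<subseteq> A" "finite A"
  shows "(\<Prod>a\<in>A - U. q ^ N - q ^ a) * (\<Prod>a\<in>U. (q ^ a - 1) * q ^ N) *
    vand A (\<lambda>a. if a \<in> U then q ^ a else q * q ^ a) = 0"
proof -
  have finU: "finite U" using assms finite_subset by blast
  consider "0 \<in> U" | "N \<in> A - U" | a where "0 \<notin> U" "a \<in> U" "a - 1 \<in> A - U"
    using assms by (auto simp: valid_step_def)
  then show ?thesis
  proof cases
    case 1
    then have "(\<Prod>a\<in>U. (q ^ a - 1) * q ^ N) = 0"
      using finU by (intro prod_zero bexI[of _ 0]) auto
    then show ?thesis by simp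
  next
    case 2
    then have "(\<Prod>a\<in>A - U. q ^ N - q ^ a) = 0"
      using assms(3) by (intro prod_zero bexI[of _ N]) auto
    then show ?thesis by simp
  next
    case 3
    then have "a > 0" by (cases a) auto
    then have "q ^ a = q * q ^ (a - 1)" by (simp add: power_eq_if)
    then have "(if a \<in> U then q ^ a else q * q ^ a) -
        (if a - 1 \<in> U then q ^ (a - 1) else q * q ^ (a - 1)) = 0"
      using 3 by simp
    moreover have "a - 1 \<in> {b\<in>A. b < a}" "finite {b\<in>A. b < a}"
      using 3 assms(3) \<open>a > 0\<close> by auto
    ultimately have "(\<Prod>b\<in>{b\<in>A. b < a}. (if a \<in> U then q ^ a else q * q ^ a) -
        (if b \<in> U then q ^ b else q * q ^ b)) = 0"
      by (subst prod_zero) blast+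
    then have "vand A (\<lambda>a. if a \<in> U then q ^ a else q * q ^ a) = 0"
      unfolding vand_def by (rule prod_zero[OF assms(3) bexI]) (use 3 assms(2) in blast)
    then show ?thesis by simp
  qed
qed

text \<open>By \<open>vand_complement\<close> this says that \<open>F c A\<close> times
  \<open>vand {..<c}\<close> is a power of the weight times the Vandermonde product of the holes, up
  to the factor formed by the \<open>qdists\<close>. It is phrased in terms of \<open>A\<close> so
  that the sum over one strip is an instance of \<open>branching_vand\<close>. The power treats all
  down-steps as if they had the weight \<open>q ^ (m - c) * t\<close> of the last strip; the
  Vandermonde products account for the difference. \<open>F\<close> is abstract because only its
  recursion matters.\<close>

lemma walker_sum:
  fixes F :: "nat \<Rightarrow> nat set \<Rightarrow> 'a::idom" and q t :: 'a
  assumes q: "q \<noteq> 0"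
    and F0: "F 0 {..<n} = 1"
    and rec: "\<And>c A. c < m \<Longrightarrow> A \<subseteq> {..<n + Suc c} \<Longrightarrow> card A = n \<Longrightarrow>
      F (Suc c) A = (\<Sum>U | valid_step (n + c) A U.
        (q ^ (m - Suc c) * t) ^ card (A - U) * F c (step_back A U))"
    and "c \<le> m" "A \<subseteq> {..<n + c}" "card A = n"
  shows "F c A * vand {..<c} ((^) q) * (\<Prod>a\<in>A. qdists q (n + c) a) =
    (q ^ (m - c) * t) ^ downs n c A * vand {..<n + c} ((^) q) * vand A ((^) q)"
  using assms(4-6)
proof (induction c arbitrary: A)
  case 0
  then have "A = {..<n}" by (simp add: card_subset_eq)
  moreover have "\<Sum>{..<k} = k choose 2" for k :: nat
    by (induction k) (auto simp: numeral_2_eq_2)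
  ultimately show ?case
    using F0 prod_qdist_eq_vand_square[of "{..<n}" q]
    by (simp add: qdists_def downs_def power2_eq_square) (simp add: vand_def)
next
  case (Suc c)
  let ?N = "n + c" and ?p = "(^) q"
  define s where "s = q ^ (m - Suc c) * t"
  define d where "d = downs n (Suc c) A"
  define R where "R = (\<Prod>b<c. q ^ c - q ^ b)"
  \<comment> \<open>The power of \<open>q\<close> that one strip costs. Each path contributes one
    factor: on a down-step it turns \<open>s\<close> into \<open>q * s\<close>, on an up-step it is
    absorbed by \<open>qdists_step_back\<close>. The remaining \<open>n choose 2\<close> factors
    belong to \<open>vand_step_back\<close>.\<close>
  define E where "E = n + (n choose 2)"
  define W where "W = (\<Prod>a\<in>A. qdists q (Suc ?N) a)"
  define T where "T = vand {..<?N} ?p"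
  define G where "G U = (\<Prod>a\<in>A - U. q ^ ?N - q ^ a) * (\<Prod>a\<in>U. (q ^ a - 1) * q ^ ?N)" for U
  have qs: "q ^ (m - c) * t = q * s"
  proof -
    have "m - c = Suc (m - Suc c)" using Suc.prems by simp
    then show ?thesis by (simp add: s_def)
  qed
  have A: "A \<subseteq> {..<Suc ?N}" using Suc.prems by simp
  have finA: "finite A" using A finite_subset by blast
  have d: "d + \<Sum>A = n * Suc c + (n choose 2)"
    unfolding d_def using Suc.prems by (intro downs_add_sum) auto
  have summand: "q ^ E * (s ^ card (A - U) * F c (step_back A U) * (vand {..<c} ?p * W)) =
      (q * s) ^ d * T * (G U * vand A (\<lambda>a. if a \<in> U then q ^ a else q * q ^ a))"
    if U: "valid_step ?N A U" for U
  proof -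
    let ?B = "step_back A U"
    note B = step_back_subset[OF U A] card_step_back[OF U A] sum_step_back[OF U A]
    have cU: "card U + card (A - U) = n"
      using U finA Suc.prems by (metis valid_step_def add_diff_inverse_nat card_Diff_subset
        card_mono finite_subset not_le)
    have dB: "downs n c ?B + \<Sum>?B = n * c + (n choose 2)"
      using B Suc.prems by (intro downs_add_sum) auto
    have dd: "d = downs n c ?B + card (A - U)"
      using d dB B(3) cU by simp
    have IH: "F c ?B * vand {..<c} ?p * (\<Prod>a\<in>?B. qdists q ?N a) =
        (q * s) ^ downs n c ?B * T * vand ?B ?p"
      using Suc.IH[of ?B] B Suc.prems by (simp add: qs T_def)
    have "q ^ E = q ^ card (A - U) * (q ^ card U * q ^ (n choose 2))"
      by (simp add: E_def power_add[symmetric] cU[symmetric] ac_simps)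
    then have "q ^ E * (s ^ card (A - U) * F c ?B * (vand {..<c} ?p * W)) =
        (q * s) ^ card (A - U) * q ^ (n choose 2) * F c ?B * vand {..<c} ?p * (q ^ card U * W)"
      by (simp add: power_mult_distrib mult_ac)
    also have "\<dots> = (q * s) ^ card (A - U) * q ^ (n choose 2) *
        (F c ?B * vand {..<c} ?p * (\<Prod>a\<in>?B. qdists q ?N a)) * G U"
      unfolding W_def qdists_step_back[OF U A] by (simp add: G_def mult_ac)
    also have "\<dots> = (q * s) ^ d * T * (G U * (q ^ (card A choose 2) * vand ?B ?p))"
      unfolding IH dd by (simp add: power_add Suc.prems mult_ac)
    finally show ?thesis unfolding vand_step_back[OF U A] .
  qed
  have "q ^ E * (F (Suc c) A * vand {..<c} ?p * W) =
      (\<Sum>U | valid_step ?N A U.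
        q ^ E * (s ^ card (A - U) * F c (step_back A U) * (vand {..<c} ?p * W)))"
    using Suc.prems
    by (simp add: rec s_def sum_distrib_left sum_distrib_right mult_ac)
  also have "\<dots> = (\<Sum>U | valid_step ?N A U.
      (q * s) ^ d * T * (G U * vand A (\<lambda>a. if a \<in> U then q ^ a else q * q ^ a)))"
    by (rule sum.cong[OF refl]) (use summand in auto)
  also have "\<dots> = (\<Sum>U\<in>Pow A.
      (q * s) ^ d * T * (G U * vand A (\<lambda>a. if a \<in> U then q ^ a else q * q ^ a)))"
    using finA invalid_step_vanishes[of ?N A _ q]
    by (intro sum.mono_neutral_left) (auto simp: G_def valid_step_def)
  also have "\<dots> = (q * s) ^ d * T * ((\<Prod>j<n. q ^ ?N - q ^ j) * (\<Prod>a\<in>A. q ^ a) * vand A ?p)"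
    unfolding sum_distrib_left[symmetric] G_def
    using branching_vand[OF finA \<open>card A = n\<close>, of "q ^ ?N" ?p q] by simp
  finally have main: "q ^ E * (F (Suc c) A * vand {..<c} ?p * W) =
      (q * s) ^ d * T * ((\<Prod>j<n. q ^ ?N - q ^ j) * q ^ \<Sum>A * vand A ?p)"
    by (simp add: power_sum)
  have split: "(\<Prod>b<n + k. f b) = (\<Prod>b<n. f b) * (\<Prod>b<k. f (n + b))" for k and f :: "nat \<Rightarrow> 'a"
    by (induction k) (auto simp: mult.assoc)
  \<comment> \<open>The first \<open>n\<close> factors are the constant of the branching identity;
    the other \<open>c\<close> are \<open>q ^ n\<close> times the factors by which
    \<open>vand {..<c}\<close> grows to \<open>vand {..<Suc c}\<close>.\<close>
  have "(\<Prod>b<?N. q ^ ?N - q ^ b) = (\<Prod>j<n. q ^ ?N - q ^ j) * (\<Prod>b<c. q ^ n * (q ^ c - q ^ b))"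
    unfolding split by (simp add: power_add algebra_simps)
  also have "\<dots> = (\<Prod>j<n. q ^ ?N - q ^ j) * (q ^ (n * c) * R)"
    by (simp add: R_def prod.distrib power_mult)
  finally have TN: "vand {..<Suc ?N} ?p = T * ((\<Prod>j<n. q ^ ?N - q ^ j) * (q ^ (n * c) * R))"
    by (simp add: vand_lessThan_Suc T_def)
  \<comment> \<open>The power with exponent \<open>\<Sum>A\<close> stems from the product of the
    \<open>y a\<close> in \<open>branching_vand\<close>. Together with the \<open>d\<close> powers
    left over from \<open>q * s\<close> it matches \<open>q ^ E\<close> and the
    \<open>q ^ (n * c)\<close> of the previous step.\<close>
  have qd: "q ^ d * q ^ \<Sum>A = q ^ E * q ^ (n * c)"
    by (simp add: power_add[symmetric] d E_def algebra_simps)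
  have "q ^ E * (F (Suc c) A * vand {..<Suc c} ?p * W) =
      q ^ E * (F (Suc c) A * vand {..<c} ?p * W) * R"
    by (simp add: vand_lessThan_Suc R_def mult_ac)
  also have "\<dots> = (q ^ d * q ^ \<Sum>A) * (s ^ d * T * R * (\<Prod>j<n. q ^ ?N - q ^ j) * vand A ?p)"
    unfolding main by (simp add: power_mult_distrib mult_ac)
  also have "\<dots> = q ^ E * (s ^ d * vand {..<Suc ?N} ?p * vand A ?p)"
    unfolding qd TN by (simp add: mult_ac)
  finally have "F (Suc c) A * vand {..<Suc c} ?p * W = s ^ d * vand {..<Suc ?N} ?p * vand A ?p"
    using q by simp
  then show ?case by (simp add: W_def s_def d_def)
qed

section \<open>A Pieri rule\<close>

text \<open>Moving the choice in block \<open>i\<close> from \<open>hi i\<close> down to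
  \<open>f i\<close> pushes the elements of \<open>D\<close> from \<open>f i\<close> to
  \<open>hi i - 1\<close> up by one. Choice functions thus correspond to the sets \<open>U\<close>
  of pushed elements that form a final segment of \<open>{lo i..<hi i}\<close> in every block. Any
  other \<open>U\<close> contains some \<open>d\<close> but not its successor in the same block, and
  then two entries of the Vandermonde product coincide.\<close>

lemma pieri_blocks:
  fixes q t :: "'a::idom" and lo hi :: "'i \<Rightarrow> nat"
  assumes I: "finite I" and le: "\<And>i. i \<in> I \<Longrightarrow> lo i \<le> hi i"
    and disj: "\<And>i j. i \<in> I \<Longrightarrow> j \<in> I \<Longrightarrow> i \<noteq> j \<Longrightarrow> {lo i..hi i} \<inter> {lo j..hi j} = {}"
  defines "D \<equiv> \<Union>i\<in>I. {lo i..<hi i}"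
  shows "(\<Sum>f\<in>PiE I (\<lambda>i. {lo i..hi i}).
      t ^ (\<Sum>i\<in>I. hi i - f i) * vand ((\<Union>i\<in>I. {lo i..hi i}) - f ` I) ((^) q)) =
    (\<Prod>j<card D. 1 + t * q ^ j) * vand D ((^) q)"
proof -
  let ?B = "\<lambda>i. {lo i..hi i}"
  have blk: "i = j" if "i \<in> I" "j \<in> I" "d \<in> ?B i" "d \<in> ?B j" for i j d
    using disj[of i j] that by blast
  have finD: "finite D" using I by (simp add: D_def)
  define z where "z = (\<lambda>U (d::nat). if d \<in> U then Suc d else d)"
  define \<Phi> where "\<Phi> = (\<lambda>f. \<Union>i\<in>I. {f i..<hi i})"
  have mem: "d \<in> \<Phi> f \<longleftrightarrow> f i \<le> d" if "f \<in> PiE I ?B" "i \<in> I" "lo i \<le> d" "d < hi i" for f d i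
  proof
    assume "d \<in> \<Phi> f"
    then obtain j where j: "j \<in> I" "f j \<le> d" "d < hi j" by (auto simp: \<Phi>_def)
    then have "d \<in> ?B j" using that(1) by (fastforce dest: PiE_mem)
    then have "i = j" using blk[of i j d] that j by auto
    then show "f i \<le> d" using j by simp
  qed (use that in \<open>auto simp: \<Phi>_def\<close>)
  have sub: "\<Phi> f \<subseteq> D" if "f \<in> PiE I ?B" for f
  proof
    fix d assume "d \<in> \<Phi> f"
    then obtain i where i: "i \<in> I" "f i \<le> d" "d < hi i" by (auto simp: \<Phi>_def)
    then have "lo i \<le> f i" using PiE_mem[OF that, of i] by simp
    then show "d \<in> D" using i by (auto simp: D_def intro!: bexI[of _ i])
  qed
  have inj: "inj_on \<Phi> (PiE I ?B)"
  proof (rule inj_onI, rule PiE_ext)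
    fix f g i assume f: "f \<in> PiE I ?B" and g: "g \<in> PiE I ?B" and eq: "\<Phi> f = \<Phi> g" and i: "i \<in> I"
    have fg: "lo i \<le> f i" "f i \<le> hi i" "lo i \<le> g i" "g i \<le> hi i"
      using f g i by (fastforce dest: PiE_mem)+
    show "f i = g i"
    proof (rule ccontr)
      assume "f i \<noteq> g i"
      then consider "f i < g i" | "g i < f i" by linarith
      then show False
        using mem[OF f i, of "f i"] mem[OF g i, of "f i"] mem[OF f i, of "g i"] mem[OF g i, of "g i"]
          fg eq by cases auto
    qed
  qed
  have vanish: "vand D (\<lambda>d. q ^ z U d) = 0" if U: "U \<subseteq> D" "U \<notin> \<Phi> ` PiE I ?B" for U
  proof -
    have "\<exists>d\<in>U. Suc d \<in> D - U"
    proof (rule ccontr)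
      assume "\<not> ?thesis"
      then have up: "Suc d \<in> U" if "d \<in> U" "Suc d \<in> D" for d using that by blast
      \<comment> \<open>The lowest pushed element of each block, or \<open>hi i\<close> if none is
        pushed.\<close>
      define f where "f = restrict (\<lambda>i. Min (insert (hi i) (U \<inter> {lo i..<hi i}))) I"
      have f_le: "f i \<le> d" if "i \<in> I" "d \<in> U" "lo i \<le> d" "d < hi i" for i d
        using that by (auto simp: f_def intro!: Min_le)
      have f_cases: "f i \<in> insert (hi i) (U \<inter> {lo i..<hi i})" if "i \<in> I" for i
        using that Min_in[of "insert (hi i) (U \<inter> {lo i..<hi i})"] by (simp add: f_def)
      have f: "f \<in> PiE I ?B"
      proof (rule PiE_I)
        show "f i \<in> ?B i" if "i \<in> I" for i using f_cases[OF that] le[OF that] by auto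
      qed (auto simp: f_def)
      have "d \<in> U" if "f i \<le> d" "d < hi i" "i \<in> I" for i d
        using that
      proof (induction d rule: dec_induct)
        case base
        then show ?case using f_cases[of i] by auto
      next
        case (step d)
        moreover have "lo i \<le> f i" using f_cases[of i] le[of i] step by auto
        ultimately have "Suc d \<in> D" unfolding D_def by (intro UN_I[of i]) auto
        then show ?case using step up by auto
      qed
      then have "\<Phi> f = U"
        using U(1) f_le by (fastforce simp: \<Phi>_def D_def)
      then show False using f U(2) by blast
    qed
    then obtain d where d: "d \<in> U" "Suc d \<in> D" "Suc d \<notin> U" by auto
    have "(\<Prod>a\<in>{a\<in>D. a < Suc d}. q ^ z U (Suc d) - q ^ z U a) = 0"
      using d U(1) finD by (intro prod_zero bexI[of _ d]) (auto simp: z_def)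
    then show ?thesis
      unfolding vand_def by (rule prod_zero[OF finD bexI]) (use d in blast)
  qed
  have summand: "t ^ card (\<Phi> f) * vand D (\<lambda>d. q ^ z (\<Phi> f) d) =
      t ^ (\<Sum>i\<in>I. hi i - f i) * vand ((\<Union>i\<in>I. ?B i) - f ` I) ((^) q)"
    if f: "f \<in> PiE I ?B" for f
  proof -
    have fi: "lo i \<le> f i" "f i \<le> hi i" if "i \<in> I" for i
      using f that by (fastforce dest: PiE_mem)+
    have card: "card (\<Phi> f) = (\<Sum>i\<in>I. hi i - f i)"
      unfolding \<Phi>_def using I
    proof (subst card_UN_disjoint)
      show "\<forall>i\<in>I. \<forall>j\<in>I. i \<noteq> j \<longrightarrow> {f i..<hi i} \<inter> {f j..<hi j} = {}"
      proof (intro ballI impI equals0I)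
        fix i j x assume "i \<in> I" "j \<in> I" "i \<noteq> j" "x \<in> {f i..<hi i} \<inter> {f j..<hi j}"
        then show False using fi[of i] fi[of j] blk[of i j x] by auto
      qed
    qed auto
    \<comment> \<open>Monotonicity could only fail at \<open>a\<close> pushed and
      \<open>Suc a\<close> not pushed; both lie in one block, where \<open>\<Phi> f\<close> is
      closed upwards.\<close>
    have mono: "strict_mono_on D (z (\<Phi> f))"
    proof (rule strict_mono_onI, rule ccontr)
      fix a b assume ab: "a \<in> D" "b \<in> D" "a < b" "\<not> z (\<Phi> f) a < z (\<Phi> f) b"
      then have "a \<in> \<Phi> f" "b \<notin> \<Phi> f" "b = Suc a" by (auto simp: z_def split: if_splits)
      moreover obtain i where i: "i \<in> I" "lo i \<le> b" "b < hi i" using ab by (auto simp: D_def)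
      moreover obtain j where j: "j \<in> I" "lo j \<le> a" "a < hi j" using ab by (auto simp: D_def)
      ultimately have "i = j" using blk[of i j b] by auto
      then show False
        using mem[OF f, of i a] mem[OF f, of i b] i j \<open>a \<in> \<Phi> f\<close> \<open>b \<notin> \<Phi> f\<close> \<open>b = Suc a\<close> by auto
    qed
    have "z (\<Phi> f) ` D = (\<Union>i\<in>I. ?B i) - f ` I"
    proof (intro subset_antisym subsetI)
      fix x assume "x \<in> z (\<Phi> f) ` D"
      then obtain i d where d: "x = z (\<Phi> f) d" "i \<in> I" "lo i \<le> d" "d < hi i"
        by (auto simp: D_def)
      then have x: "x \<in> ?B i" "x \<noteq> f i"
        using mem[OF f d(2-4)] by (auto simp: z_def)
      have "x \<noteq> f j" if "j \<in> I" for j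
        using x blk[of i j x] d(2) that fi[OF that] by auto
      then show "x \<in> (\<Union>i\<in>I. ?B i) - f ` I" using x d(2) by auto
    next
      fix x assume "x \<in> (\<Union>i\<in>I. ?B i) - f ` I"
      then obtain i where i: "i \<in> I" "lo i \<le> x" "x \<le> hi i" "x \<noteq> f i" by auto
      show "x \<in> z (\<Phi> f) ` D"
      proof (cases "x < f i")
        case True
        then have "z (\<Phi> f) x = x" "x \<in> D"
          using mem[OF f, of i x] i fi[OF i(1)] by (auto simp: z_def D_def)
        then show ?thesis by force
      next
        case False
        then obtain y where y: "x = Suc y" "f i \<le> y" using i by (cases x) auto
        then have "z (\<Phi> f) y = x" "y \<in> D"
          using mem[OF f, of i y] i fi[OF i(1)] by (auto simp: z_def D_def intro!: bexI[of _ i])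
        then show ?thesis by force
      qed
    qed
    then show ?thesis
      using vand_reindex[OF mono, of "(^) q"] by (simp add: card o_def)
  qed
  have "(\<Prod>j<card D. 1 + t * q ^ j) * vand D ((^) q) =
      (\<Sum>U\<in>Pow D. t ^ card U * vand D (\<lambda>d. q ^ z U d))"
    unfolding pieri_vand[OF finD refl, symmetric]
    by (intro sum.cong refl arg_cong2[of _ _ _ _ "(*)"] arg_cong[of _ _ "vand D"])
      (auto simp: z_def)
  also have "\<dots> = (\<Sum>U\<in>\<Phi> ` PiE I ?B. t ^ card U * vand D (\<lambda>d. q ^ z U d))"
    using finD sub vanish by (intro sum.mono_neutral_right) auto
  also have "\<dots> = (\<Sum>f\<in>PiE I ?B. t ^ card (\<Phi> f) * vand D (\<lambda>d. q ^ z (\<Phi> f) d))"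
    by (simp add: sum.reindex[OF inj])
  finally show ?thesis
    using summand by (simp cong: sum.cong)
qed

section \<open>Weighted sums over tilings\<close>

text \<open>The predicate \<open>E\<close> selects the admissible tiles; the peeling arguments below
  are independent of the geometry of the lattice.\<close>

definition tilings :: "('v set \<Rightarrow> bool) \<Rightarrow> 'v set \<Rightarrow> 'v set set set" where
  "tilings E R = {\<tau>. partition_on R \<tau> \<and> (\<forall>L\<in>\<tau>. E L)}"

definition tiling_sum :: "('v set \<Rightarrow> bool) \<Rightarrow> ('v set \<Rightarrow> 'a::comm_semiring_1) \<Rightarrow> 'v set \<Rightarrow> 'a" where
  "tiling_sum E w R = (\<Sum>\<tau>\<in>tilings E R. \<Prod>L\<in>\<tau>. w L)"

lemma finite_tilings: "finite R \<Longrightarrow> finite (tilings E R)"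
  by (rule finite_subset[of _ "Pow (Pow R)"]) (auto simp: tilings_def partition_on_def)

lemma finite_tiling: "finite R \<Longrightarrow> \<tau> \<in> tilings E R \<Longrightarrow> finite \<tau>"
  by (rule finite_subset[of _ "Pow R"]) (auto simp: tilings_def partition_on_def)

lemma tiling_sum_empty: "tiling_sum E w {} = 1"
proof -
  have "tilings E {} = {{}}" by (auto simp: tilings_def partition_on_def)
  then show ?thesis by (simp add: tiling_sum_def)
qed

text \<open>Exactly one tile covers \<open>v\<close>, and it has exactly one further element. No
  other tile contains \<open>v\<close>, so the removed tile can be recovered.\<close>

lemma tiling_sum_peel:
  assumes "finite R" "v \<in> R" and E: "\<And>L. E L \<Longrightarrow> v \<in> L \<Longrightarrow> \<exists>u. u \<noteq> v \<and> L = {v, u}"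
  shows "tiling_sum E w R =
    (\<Sum>u | u \<in> R \<and> u \<noteq> v \<and> E {v, u}. w {v, u} * tiling_sum E w (R - {v, u}))"
proof -
  let ?N = "{u \<in> R. u \<noteq> v \<and> E {v, u}}"
  let ?S = "Sigma ?N (\<lambda>u. tilings E (R - {v, u}))"
  let ?f = "\<lambda>(u, \<sigma>). insert {v, u} \<sigma>"
  have v: "v \<notin> \<Union>\<sigma>" if "\<sigma> \<in> tilings E (R - {v, u})" for \<sigma> u
    using that by (auto simp: tilings_def partition_on_def)
  have inj: "inj_on ?f ?S"
  proof (rule inj_onI, clarify)
    fix u \<sigma> u' \<sigma>'
    assume *: "\<sigma> \<in> tilings E (R - {v, u})" "\<sigma>' \<in> tilings E (R - {v, u'})"
      "insert {v, u} \<sigma> = insert {v, u'} \<sigma>'"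
    have notin: "{v, x} \<notin> \<sigma>" "{v, x} \<notin> \<sigma>'" for x
      using v[OF *(1)] v[OF *(2)] by blast+
    have "{v, u} \<in> insert {v, u'} \<sigma>'" using *(3) by blast
    then have "{v, u} = {v, u'}" using notin(2)[of u] by (simp only: insert_iff) blast
    then have "u = u'" by (auto simp: doubleton_eq_iff)
    moreover have "\<sigma> = \<sigma>'"
      using *(3) insert_ident[OF notin(1)[of u'] notin(2)[of u']] unfolding \<open>u = u'\<close> by simp
    ultimately show "u = u' \<and> \<sigma> = \<sigma>'" ..
  qed
  have image: "tilings E R = ?f ` ?S"
  proof (intro subset_antisym subsetI)
    fix \<tau> assume \<tau>: "\<tau> \<in> tilings E R"
    then obtain L where L: "L \<in> \<tau>" "v \<in> L" "E L"
      using assms(2) by (auto simp: tilings_def partition_on_def)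
    then obtain u where u: "u \<noteq> v" "L = {v, u}" using E by blast
    have "X \<inter> L = {}" if "X \<in> \<tau>" "X \<noteq> L" for X
      using \<tau> L(1) that by (auto simp: tilings_def partition_on_def disjoint_def)
    then have "\<Union>(\<tau> - {L}) = R - {v, u}"
      using \<tau> L(1) unfolding u by (auto simp: tilings_def partition_on_def)
    then have "\<tau> - {L} \<in> tilings E (R - {v, u})"
      using \<tau> by (auto simp: tilings_def partition_on_def disjoint_def)
    moreover have "u \<in> ?N" using \<tau> L u by (auto simp: tilings_def partition_on_def)
    moreover have "?f (u, \<tau> - {L}) = \<tau>" using L u by auto
    ultimately show "\<tau> \<in> ?f ` ?S"
      by (intro image_eqI[of _ ?f "(u, \<tau> - {L})"] SigmaI) simp_all
  next
    fix \<tau> assume "\<tau> \<in> ?f ` ?S"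
    then obtain u \<sigma> where "u \<in> ?N" "\<sigma> \<in> tilings E (R - {v, u})" "\<tau> = insert {v, u} \<sigma>" by auto
    then show "\<tau> \<in> tilings E R"
      using assms(2) by (auto simp: tilings_def partition_on_def disjoint_def)
  qed
  have "tiling_sum E w R = (\<Sum>(u, \<sigma>)\<in>?S. w {v, u} * (\<Prod>L\<in>\<sigma>. w L))"
    unfolding tiling_sum_def image sum.reindex[OF inj]
  proof (rule sum.cong[OF refl], clarsimp)
    fix u \<sigma> assume \<sigma>: "\<sigma> \<in> tilings E (R - {v, u})"
    then have "finite \<sigma>" using assms(1) by (intro finite_tiling[of "R - {v, u}"]) auto
    moreover have "{v, u} \<notin> \<sigma>" using v[OF \<sigma>] by blast
    ultimately show "prod w (insert {v, u} \<sigma>) = w {v, u} * prod w \<sigma>" by simp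
  qed
  then show ?thesis
    using assms(1) by (simp add: sum.Sigma[symmetric] finite_tilings sum_distrib_left tiling_sum_def)
qed

text \<open>Partners of the elements of \<open>X\<close>. Extensionality makes each choice of
  partners a single function, and injectivity keeps the tiles disjoint.\<close>

definition matchings :: "('v set \<Rightarrow> bool) \<Rightarrow> 'v set \<Rightarrow> 'v set \<Rightarrow> ('v \<Rightarrow> 'v) set" where
  "matchings E R X = {\<phi> \<in> PiE X (\<lambda>x. {u \<in> R. E {x, u}}). inj_on \<phi> X}"

lemma finite_matchings: "finite R \<Longrightarrow> finite X \<Longrightarrow> finite (matchings E R X)"
  unfolding matchings_def by (rule finite_subset[OF _ finite_PiE[of X "\<lambda>x. {u \<in> R. E {x, u}}"]]) auto

text \<open>No tile has two elements in \<open>X\<close>, so the tiles that meet \<open>X\<close>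
  are pairs with distinct partners outside \<open>X\<close>, and they can be peeled off one by
  one.\<close>

lemma tiling_sum_peel_set:
  assumes "finite X" "finite R" "X \<subseteq> R"
    and "\<And>L x. E L \<Longrightarrow> x \<in> X \<Longrightarrow> x \<in> L \<Longrightarrow> \<exists>u. u \<notin> X \<and> L = {x, u}"
  shows "tiling_sum E w R =
    (\<Sum>\<phi>\<in>matchings E R X. (\<Prod>x\<in>X. w {x, \<phi> x}) * tiling_sum E w (R - X - \<phi> ` X))"
  using assms
proof (induction X arbitrary: R rule: finite_induct)
  case empty
  then show ?case by (simp add: matchings_def)
next
  case (insert x X)
  note E = insert.prems(3)
  let ?N = "{u \<in> R. u \<noteq> x \<and> E {x, u}}"
  let ?S = "Sigma ?N (\<lambda>u. matchings E (R - {x, u}) X)"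
  let ?f = "\<lambda>(u, \<phi>). \<phi>(x := u)"
  have NX: "u \<notin> insert x X" if "E {y, u}" "y \<in> insert x X" for u y
    using E[OF that(1) that(2)] by (auto simp: doubleton_eq_iff)
  have inj: "inj_on ?f ?S"
  proof (rule inj_onI, clarify)
    fix u \<phi> u' \<phi>'
    assume *: "\<phi> \<in> matchings E (R - {x, u}) X" "\<phi>' \<in> matchings E (R - {x, u'}) X"
      "\<phi>(x := u) = \<phi>'(x := u')"
    have "\<phi> x = undefined" "\<phi>' x = undefined"
      using *(1,2) insert.hyps by (auto simp: matchings_def PiE_def extensional_def)
    have "\<phi> y = \<phi>' y \<and> u = u'" for y
      using fun_cong[OF *(3), of y] fun_cong[OF *(3), of x] \<open>\<phi> x = undefined\<close> \<open>\<phi>' x = undefined\<close>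
      by (cases "y = x") auto
    then show "u = u' \<and> \<phi> = \<phi>'" by blast
  qed
  have image: "matchings E R (insert x X) = ?f ` ?S"
  proof (intro subset_antisym subsetI)
    fix \<phi> assume \<phi>: "\<phi> \<in> matchings E R (insert x X)"
    have mem: "\<phi> y \<in> R" "E {y, \<phi> y}" "\<phi> y \<notin> insert x X" if "y \<in> insert x X" for y
    proof -
      have "\<phi> \<in> PiE (insert x X) (\<lambda>x. {u \<in> R. E {x, u}})"
        using \<phi> by (simp add: matchings_def)
      from PiE_mem[OF this that] show "\<phi> y \<in> R" "E {y, \<phi> y}" by auto
      then show "\<phi> y \<notin> insert x X" using NX that by blast
    qed
    have inj\<phi>: "inj_on \<phi> (insert x X)" using \<phi> by (simp add: matchings_def)
    define \<psi> where "\<psi> = \<phi>(x := undefined)"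
    have "\<psi> \<in> matchings E (R - {x, \<phi> x}) X"
      unfolding matchings_def
    proof (rule CollectI, rule conjI, rule PiE_I)
      show "\<psi> y \<in> {u \<in> R - {x, \<phi> x}. E {y, u}}" if "y \<in> X" for y
        using mem[of y] that insert.hyps inj_onD[OF inj\<phi>, of y x] by (auto simp: \<psi>_def)
      show "\<psi> y = undefined" if "y \<notin> X" for y
        using \<phi> that by (auto simp: \<psi>_def matchings_def PiE_def extensional_def)
      show "inj_on \<psi> X"
        using inj\<phi> insert.hyps by (auto simp: \<psi>_def inj_on_def)
    qed
    moreover have "\<phi> = ?f (\<phi> x, \<psi>)" by (simp add: \<psi>_def)
    moreover have "\<phi> x \<in> ?N" using mem[of x] by auto
    ultimately show "\<phi> \<in> ?f ` ?S" by (intro image_eqI[of _ ?f "(\<phi> x, \<psi>)"] SigmaI)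
  next
    fix \<phi> assume "\<phi> \<in> ?f ` ?S"
    then obtain u \<psi> where *: "u \<in> ?N" "\<psi> \<in> matchings E (R - {x, u}) X" "\<phi> = \<psi>(x := u)" by auto
    then show "\<phi> \<in> matchings E R (insert x X)"
      using insert.hyps by (auto simp: matchings_def PiE_def Pi_def extensional_def inj_on_def)
  qed
  have "tiling_sum E w R = (\<Sum>u\<in>?N. w {x, u} * tiling_sum E w (R - {x, u}))"
  proof (rule tiling_sum_peel)
    show "\<exists>u. u \<noteq> x \<and> L = {x, u}" if "E L" "x \<in> L" for L
      using E[OF that(1) _ that(2)] by auto
  qed (use insert.prems in auto)
  also have "\<dots> = (\<Sum>u\<in>?N. \<Sum>\<phi>\<in>matchings E (R - {x, u}) X. w {x, u} *
      ((\<Prod>y\<in>X. w {y, \<phi> y}) * tiling_sum E w (R - {x, u} - X - \<phi> ` X)))"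
  proof (rule sum.cong[OF refl])
    fix u assume u: "u \<in> ?N"
    have "tiling_sum E w (R - {x, u}) = (\<Sum>\<phi>\<in>matchings E (R - {x, u}) X.
      (\<Prod>y\<in>X. w {y, \<phi> y}) * tiling_sum E w (R - {x, u} - X - \<phi> ` X))"
    proof (rule insert.IH)
      show "X \<subseteq> R - {x, u}" using insert.prems insert.hyps u NX[of x u] by auto
      show "\<exists>u. u \<notin> X \<and> L = {y, u}" if "E L" "y \<in> X" "y \<in> L" for L y
        using E[OF that(1) _ that(3)] that(2) by auto
    qed (use insert.prems in auto)
    then show "w {x, u} * tiling_sum E w (R - {x, u}) = (\<Sum>\<phi>\<in>matchings E (R - {x, u}) X. w {x, u} *
      ((\<Prod>y\<in>X. w {y, \<phi> y}) * tiling_sum E w (R - {x, u} - X - \<phi> ` X)))"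
      by (simp add: sum_distrib_left)
  qed
  also have "\<dots> = (\<Sum>(u, \<phi>)\<in>?S. w {x, u} *
      ((\<Prod>y\<in>X. w {y, \<phi> y}) * tiling_sum E w (R - {x, u} - X - \<phi> ` X)))"
    using insert.prems insert.hyps by (subst sum.Sigma) (auto simp: finite_matchings)
  also have "\<dots> = (\<Sum>\<phi>\<in>matchings E R (insert x X). (\<Prod>y\<in>insert x X. w {y, \<phi> y}) *
      tiling_sum E w (R - insert x X - \<phi> ` insert x X))"
    unfolding image sum.reindex[OF inj]
  proof (rule sum.cong[OF refl])
    fix p assume "p \<in> ?S"
    obtain u \<phi> where p: "p = (u, \<phi>)" by (cases p)
    have "(\<Prod>y\<in>X. w {y, (\<phi>(x := u)) y}) = (\<Prod>y\<in>X. w {y, \<phi> y})"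
      using insert.hyps by (intro prod.cong) auto
    then have "(\<Prod>y\<in>insert x X. w {y, (\<phi>(x := u)) y}) = w {x, u} * (\<Prod>y\<in>X. w {y, \<phi> y})"
      using insert.hyps by simp
    moreover have "(\<phi>(x := u)) ` insert x X = insert u (\<phi> ` X)" using insert.hyps by auto
    moreover have "R - {x, u} - X - \<phi> ` X = R - insert x X - insert u (\<phi> ` X)" by auto
    ultimately show "(case p of (u, \<phi>) \<Rightarrow> w {x, u} *
        ((\<Prod>y\<in>X. w {y, \<phi> y}) * tiling_sum E w (R - {x, u} - X - \<phi> ` X))) =
      ((\<lambda>\<phi>. (\<Prod>y\<in>insert x X. w {y, \<phi> y}) *
        tiling_sum E w (R - insert x X - \<phi> ` insert x X)) \<circ> ?f) p"
      by (simp only: p split comp_apply mult.assoc)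
  qed
  finally show ?case .
qed

lemma tiling_sum_forced:
  assumes "finite R" "X \<subseteq> R" "inj_on g X"
    and "\<And>L x. E L \<Longrightarrow> x \<in> X \<Longrightarrow> x \<in> L \<Longrightarrow> \<exists>u. u \<notin> X \<and> L = {x, u}"
    and g: "\<And>x. x \<in> X \<Longrightarrow> {u \<in> R. E {x, u}} = {g x}"
  shows "tiling_sum E w R = (\<Prod>x\<in>X. w {x, g x}) * tiling_sum E w (R - X - g ` X)"
proof -
  have "PiE X (\<lambda>x. {u \<in> R. E {x, u}}) = PiE X (\<lambda>x. {restrict g X x})"
    by (rule PiE_cong) (simp add: g)
  also have "\<dots> = {restrict g X}" by (rule PiE_singleton) (rule restrict_extensional)
  finally have "PiE X (\<lambda>x. {u \<in> R. E {x, u}}) = {restrict g X}" .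
  then have "matchings E R X = {restrict g X}"
    using assms(3) by (auto simp: matchings_def)
  moreover have "finite X" using assms(1,2) finite_subset by blast
  moreover from this have "tiling_sum E w R =
      (\<Sum>\<phi>\<in>matchings E R X. (\<Prod>x\<in>X. w {x, \<phi> x}) * tiling_sum E w (R - X - \<phi> ` X))"
    by (intro tiling_sum_peel_set assms)
  ultimately show ?thesis by simp
qed

section \<open>Triangles and lozenges\<close>

definition lt :: "int \<Rightarrow> int \<Rightarrow> triangle" where
  "lt x h = {(x, h), (x, h + 2), (x - 1, h + 1)}"

definition rt :: "int \<Rightarrow> int \<Rightarrow> triangle" where
  "rt x h = {(x, h), (x, h + 2), (x + 1, h + 1)}"

lemma unit_triangles_eq: "unit_triangles = {rt x h | x h. even (x + h)} \<union> {lt x h | x h. even (x + h)}"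
  by (simp add: unit_triangles_def lt_def rt_def)

text \<open>Three times the coordinates of the barycentre. They determine \<open>x\<close> and
  \<open>h\<close>, and modulo 3 the first one distinguishes left-pointing from right-pointing
  triangles.\<close>

lemma sum_lt: "(\<Sum>v\<in>lt x h. fst v) = 3 * x - 1" "(\<Sum>v\<in>lt x h. snd v) = 3 * h + 3"
  by (simp_all add: lt_def)

lemma sum_rt: "(\<Sum>v\<in>rt x h. fst v) = 3 * x + 1" "(\<Sum>v\<in>rt x h. snd v) = 3 * h + 3"
  by (simp_all add: rt_def)

lemma lt_eq_iff [simp]: "lt x h = lt x' h' \<longleftrightarrow> x = x' \<and> h = h'"
  using sum_lt[of x h] sum_lt[of x' h'] by auto

lemma rt_eq_iff [simp]: "rt x h = rt x' h' \<longleftrightarrow> x = x' \<and> h = h'"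
  using sum_rt[of x h] sum_rt[of x' h'] by auto

lemma lt_neq_rt [simp]: "lt x h \<noteq> rt x' h'" "rt x' h' \<noteq> lt x h"
proof -
  have "3 * x - 1 \<noteq> 3 * x' + 1" by presburger
  then show "lt x h \<noteq> rt x' h'" using sum_lt[of x h] sum_rt[of x' h'] by metis
  then show "rt x' h' \<noteq> lt x h" by simp
qed

lemma card_lt_Int_lt: "card (lt x h \<inter> lt x' h') = 2 \<longleftrightarrow> False" if "even (x + h)" "even (x' + h')"
  using that by (auto simp: lt_def Int_insert_left split: if_splits)

lemma card_rt_Int_rt: "card (rt x h \<inter> rt x' h') = 2 \<longleftrightarrow> False" if "even (x + h)" "even (x' + h')"
  using that by (auto simp: rt_def Int_insert_left split: if_splits)

lemma card_lt_Int_rt: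
  assumes "even (x + h)" "even (x' + h')"
  shows "card (lt x h \<inter> rt x' h') = 2 \<longleftrightarrow>
    x' = x \<and> h' = h \<or> x' = x - 1 \<and> (h' = h - 1 \<or> h' = h + 1)"
proof -
  obtain d e where "x' = x + d" "h' = h + e" by (metis add_diff_cancel_left' add.commute diff_add_cancel)
  then show ?thesis
    using assms by (simp add: lt_def rt_def Int_insert_left) presburger
qed

text \<open>The three alternatives are, in this order, the horizontal, the positive and the negative
  lozenges.\<close>

lemma lozenge_cases:
  assumes "lozenge L"
  obtains x h x' h' where "even (x + h)" "L = {lt x h, rt x' h'}"
    "x' = x \<and> h' = h \<or> x' = x - 1 \<and> (h' = h - 1 \<or> h' = h + 1)"
proof -
  obtain T T' where T: "T \<in> unit_triangles" "T' \<in> unit_triangles" "card (T \<inter> T') = 2" "L = {T, T'}"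
    using assms by (auto simp: lozenge_def)
  then consider x h x' h' where "even (x + h)" "even (x' + h')" "T = lt x h" "T' = rt x' h'"
    | x h x' h' where "even (x + h)" "even (x' + h')" "T = rt x' h'" "T' = lt x h"
    by (auto simp: unit_triangles_eq card_lt_Int_lt card_rt_Int_rt)
  then show thesis
  proof cases
    case 1
    then show thesis using T that card_lt_Int_rt by blast
  next
    case 2
    then have "L = {lt x h, rt x' h'}" "card (lt x h \<inter> rt x' h') = 2"
      using T by (auto simp: insert_commute Int_commute)
    then show thesis using 2 that card_lt_Int_rt by blast
  qed
qed

lemma lozenge_lt_rt [simp]: "lozenge {lt x h, rt x' h'} \<longleftrightarrow>
    even (x + h) \<and> (x' = x \<and> h' = h \<or> x' = x - 1 \<and> (h' = h - 1 \<or> h' = h + 1))"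
proof
  show "even (x + h) \<and> (x' = x \<and> h' = h \<or> x' = x - 1 \<and> (h' = h - 1 \<or> h' = h + 1))"
    if "lozenge {lt x h, rt x' h'}"
    by (rule lozenge_cases[OF that]) (auto simp: doubleton_eq_iff)
  assume *: "even (x + h) \<and> (x' = x \<and> h' = h \<or> x' = x - 1 \<and> (h' = h - 1 \<or> h' = h + 1))"
  then have "even (x' + h')" by auto
  with * show "lozenge {lt x h, rt x' h'}"
    unfolding lozenge_def
    by (intro bexI[of _ "lt x h"] bexI[of _ "rt x' h'"])
      (auto simp: card_lt_Int_rt unit_triangles_eq)
qed

lemma not_lozenge_lt_lt [simp]: "\<not> lozenge {lt x h, lt x' h'}"
proof
  assume "lozenge {lt x h, lt x' h'}"
  then show False by (rule lozenge_cases) (auto simp: doubleton_eq_iff)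
qed

lemma not_lozenge_rt_rt [simp]: "\<not> lozenge {rt x h, rt x' h'}"
proof
  assume "lozenge {rt x h, rt x' h'}"
  then show False by (rule lozenge_cases) (auto simp: doubleton_eq_iff)
qed

lemma long_diagonal_lt_rt:
  "long_diagonal {lt x h, rt x h} = {(x - 1, h + 1), (x + 1, h + 1)}"
  "long_diagonal {lt x h, rt (x - 1) (h - 1)} = {(x - 1, h - 1), (x, h + 2)}"
  "long_diagonal {lt x h, rt (x - 1) (h + 1)} = {(x - 1, h + 3), (x, h)}"
  by (auto simp: long_diagonal_def lt_def rt_def)

text \<open>The long diagonal is an unordered pair; \<open>x < x'\<close> leaves a single way to
  name its ends. \<open>P\<close> stands for the comparison of heights that distinguishes the three
  types.\<close>

lemma ex_long_diagonal:
  fixes a c :: int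
  assumes "a < c"
  shows "(\<exists>x h x' h'. {(a, b), (c, d)} = {(x, h), (x', h')} \<and> x < x' \<and> P h h') \<longleftrightarrow> P b d"
proof
  show "P b d" if "\<exists>x h x' h'. {(a, b), (c, d)} = {(x, h), (x', h')} \<and> x < x' \<and> P h h'"
    using that assms by (auto simp: doubleton_eq_iff)
qed (use assms in blast)

lemma horizontal_lt_rt [simp]:
  "horizontal {lt x h, rt x' h'} \<longleftrightarrow> even (x + h) \<and> x' = x \<and> h' = h" (is "?l \<longleftrightarrow> ?r")
proof (cases "lozenge {lt x h, rt x' h'}")
  case True
  then consider "x' = x" "h' = h" | "x' = x - 1" "h' = h - 1" | "x' = x - 1" "h' = h + 1"
    by (auto simp only: lozenge_lt_rt)
  then show ?thesis
  proof cases
    case 1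
    show ?thesis
      unfolding 1 horizontal_def long_diagonal_lt_rt by (subst ex_long_diagonal) auto
  next
    case 2
    show ?thesis
      unfolding 2 horizontal_def long_diagonal_lt_rt by (subst ex_long_diagonal) auto
  next
    case 3
    show ?thesis
      unfolding 3 horizontal_def long_diagonal_lt_rt by (subst ex_long_diagonal) auto
  qed
qed (auto simp: horizontal_def)

lemma negative_lt_rt [simp]:
  "negative {lt x h, rt x' h'} \<longleftrightarrow> even (x + h) \<and> x' = x - 1 \<and> h' = h + 1"
proof (cases "lozenge {lt x h, rt x' h'}")
  case True
  then consider "x' = x" "h' = h" | "x' = x - 1" "h' = h - 1" | "x' = x - 1" "h' = h + 1"
    by (auto simp only: lozenge_lt_rt)
  then show ?thesis
  proof cases
    case 1
    show ?thesis
      unfolding 1 negative_def long_diagonal_lt_rt by (subst ex_long_diagonal) auto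
  next
    case 2
    show ?thesis
      unfolding 2 negative_def long_diagonal_lt_rt by (subst ex_long_diagonal) auto
  next
    case 3
    show ?thesis
      unfolding 3 negative_def long_diagonal_lt_rt by (subst ex_long_diagonal) auto
  qed
qed (auto simp: negative_def)

lemma lozenge_weight_lt_rt: "lozenge_weight q t {lt x h, rt x' h'} =
    (if even (x + h) \<and> x' = x - 1 \<and> h' = h + 1 then q ^ nat (- x) * t else 1)"
proof -
  have "fst ` \<Union>{lt x h, rt (x - 1) (h + 1)} = {x - 1, x}"
    by (auto simp: lt_def rt_def image_iff)
  then have "Max (fst ` \<Union>{lt x h, rt (x - 1) (h + 1)}) = x" by simp
  then show ?thesis by (auto simp: lozenge_weight_def)
qed

section \<open>The left half of the hexagon\<close>

text \<open>
  Column \<open>c\<close> is the lattice line \<open>x = c - m\<close>. Inside \<open>H(m, m, n)\<close>, where \<open>c \<le> m\<close> on the left half,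
  it has \<open>n + c\<close> unit edges, numbered from the bottom; these are the triangles to the left and
  to the right of edge \<open>p\<close>.
\<close>

definition ltri :: "nat \<Rightarrow> nat \<Rightarrow> nat \<Rightarrow> triangle" where
  "ltri m c p = lt (int c - int m) (int m - int c + 2 * int p)"

definition rtri :: "nat \<Rightarrow> nat \<Rightarrow> nat \<Rightarrow> triangle" where
  "rtri m c p = rt (int c - int m) (int m - int c + 2 * int p)"

lemma ltri_eq_iff [simp]: "ltri m c p = ltri m c' p' \<longleftrightarrow> c = c' \<and> p = p'"
  by (auto simp: ltri_def)

lemma rtri_eq_iff [simp]: "rtri m c p = rtri m c' p' \<longleftrightarrow> c = c' \<and> p = p'"
  by (auto simp: rtri_def)

lemma ltri_neq_rtri [simp]: "ltri m c p \<noteq> rtri m' c' p'" "rtri m' c' p' \<noteq> ltri m c p"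
  by (simp_all add: ltri_def rtri_def)

lemma lozenge_ltri_rtri [simp]: "lozenge {ltri m c p, rtri m c' p'} \<longleftrightarrow>
    c' = c \<and> p' = p \<or> c = Suc c' \<and> (p = p' \<or> p = Suc p')"
  unfolding ltri_def rtri_def lozenge_lt_rt by (rule iffI; simp; presburger)

lemma lozenge_rtri_ltri [simp]:
  "lozenge {rtri m c' p', ltri m c p} \<longleftrightarrow> lozenge {ltri m c p, rtri m c' p'}"
  by (subst insert_commute) (rule refl)

lemma not_lozenge_ltri_ltri [simp]: "\<not> lozenge {ltri m c p, ltri m c' p'}"
  by (simp add: ltri_def)

lemma not_lozenge_rtri_rtri [simp]: "\<not> lozenge {rtri m c p, rtri m c' p'}"
  by (simp add: rtri_def)

lemma lozenge_with_ltri: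
  assumes "lozenge L" "ltri m c p \<in> L"
  shows "\<exists>x h. L = {ltri m c p, rt x h}"
  using assms(1) by (rule lozenge_cases) (use assms(2) in \<open>auto simp: ltri_def\<close>)

lemma lozenge_with_rtri:
  assumes "lozenge L" "rtri m c p \<in> L"
  shows "\<exists>x h. L = {rtri m c p, lt x h}"
  using assms(1) by (rule lozenge_cases) (use assms(2) in \<open>auto simp: rtri_def\<close>)

lemma lozenge_weight_ltri_rtri:
  "lozenge_weight q t {rtri m c p, ltri m c p} = 1"
  "lozenge_weight q t {ltri m (Suc c) (Suc p), rtri m c p} = 1"
  "c < m \<Longrightarrow> lozenge_weight q t {ltri m (Suc c) p, rtri m c p} = q ^ (m - Suc c) * t"
proof -
  have "lozenge_weight q t {ltri m c p, rtri m c p} = 1"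
    unfolding ltri_def rtri_def lozenge_weight_lt_rt by simp
  then show "lozenge_weight q t {rtri m c p, ltri m c p} = 1" by (simp add: insert_commute)
  show "lozenge_weight q t {ltri m (Suc c) (Suc p), rtri m c p} = 1"
    unfolding ltri_def rtri_def lozenge_weight_lt_rt by simp
  assume "c < m"
  then have "nat (- (int (Suc c) - int m)) = m - Suc c" by simp
  then show "lozenge_weight q t {ltri m (Suc c) p, rtri m c p} = q ^ (m - Suc c) * t"
    unfolding ltri_def rtri_def lozenge_weight_lt_rt by simp
qed

text \<open>
  The edges of column \<open>c\<close> outside \<open>A\<close> are crossed by horizontal lozenges, whose left halves do not
  belong to the region.
\<close>

definition left_region :: "nat \<Rightarrow> nat \<Rightarrow> nat \<Rightarrow> nat set \<Rightarrow> region" where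
  "left_region m n c A =
    {ltri m c' p | c' p. 0 < c' \<and> (c' < c \<and> p < n + c' \<or> c' = c \<and> p \<in> A)} \<union>
    {rtri m c' p | c' p. c' < c \<and> p < n + c'}"

lemma ltri_mem_left_region [simp]:
  "ltri m c' p \<in> left_region m n c A \<longleftrightarrow> 0 < c' \<and> (c' < c \<and> p < n + c' \<or> c' = c \<and> p \<in> A)"
  by (auto simp: left_region_def)

lemma rtri_mem_left_region [simp]:
  "rtri m c' p \<in> left_region m n c A \<longleftrightarrow> c' < c \<and> p < n + c'"
  by (auto simp: left_region_def)

lemma mem_left_regionE:
  assumes "T \<in> left_region m n c A"
  obtains c' p where "T = ltri m c' p" "0 < c'" "c' < c \<and> p < n + c' \<or> c' = c \<and> p \<in> A"
    | c' p where "T = rtri m c' p" "c' < c" "p < n + c'"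
  using assms by (auto simp: left_region_def)

lemma finite_left_region:
  assumes "finite A"
  shows "finite (left_region m n c A)"
proof (rule finite_subset)
  show "left_region m n c A \<subseteq>
      (\<lambda>(c', p). ltri m c' p) ` ({..c} \<times> ({..<n + c} \<union> A)) \<union>
      (\<lambda>(c', p). rtri m c' p) ` ({..c} \<times> {..<n + c})"
    by (force simp: left_region_def)
qed (use assms in auto)

text \<open>Once the path lozenges of a strip are gone, a triangle \<open>rtri m c p\<close> with
  \<open>p \<notin> A\<close> has no neighbour left in column \<open>Suc c\<close>, so it is forced
  into the horizontal lozenge across edge \<open>p\<close>.\<close>

lemma tiling_sum_forced_column:
  assumes A: "A \<subseteq> {..<n + c}" "card A = n"
    and w: "\<And>p. w {rtri m c p, ltri m c p} = 1"
  shows "tiling_sum lozenge w (left_region m n (Suc c) {} - rtri m c ` A) =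
    tiling_sum lozenge w (left_region m n c A)"
proof -
  let ?R = "left_region m n (Suc c) {} - rtri m c ` A"
  let ?X = "rtri m c ` ({..<n + c} - A)"
  let ?g = "\<lambda>T. ltri m c (inv_into UNIV (rtri m c) T)"
  have inj: "inj (rtri m c)" by (simp add: inj_def)
  \<comment> \<open>Column 0 has no triangles on its left, but there \<open>A\<close> consists of
    all edges and nothing is forced.\<close>
  have c0: "c > 0" if "p < n + c" "p \<notin> A" for p
  proof (rule ccontr)
    assume "\<not> c > 0"
    then have "A = {..<n}" using A by (simp add: card_subset_eq)
    then show False using that \<open>\<not> c > 0\<close> by simp
  qed
  have "tiling_sum lozenge w ?R = (\<Prod>T\<in>?X. w {T, ?g T}) * tiling_sum lozenge w (?R - ?X - ?g ` ?X)"
  proof (rule tiling_sum_forced)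
    show "finite ?R" by (simp add: finite_left_region)
    show "?X \<subseteq> ?R" by auto
    show "inj_on ?g ?X" by (auto simp: inj_on_def inv_f_f[OF inj])
    show "\<exists>u. u \<notin> ?X \<and> L = {x, u}" if L: "lozenge L" "x \<in> ?X" "x \<in> L" for L x
    proof -
      obtain p where "x = rtri m c p" using L by auto
      then obtain y h where "L = {x, lt y h}" using lozenge_with_rtri L by blast
      then show ?thesis by (intro exI[of _ "lt y h"]) (auto simp: rtri_def)
    qed
    show "{u \<in> ?R. lozenge {x, u}} = {?g x}" if x: "x \<in> ?X" for x
    proof -
      obtain p where p: "x = rtri m c p" "p < n + c" "p \<notin> A" using x by auto
      show ?thesis
      proof (intro subset_antisym subsetI)
        fix u assume "u \<in> {u \<in> ?R. lozenge {x, u}}"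
        then show "u \<in> {?g x}"
          using p by (auto elim!: mem_left_regionE simp: inv_f_f[OF inj])
      qed (use p c0[OF p(2,3)] in \<open>auto simp: inv_f_f[OF inj]\<close>)
    qed
  qed
  also have "(\<Prod>T\<in>?X. w {T, ?g T}) = 1"
    by (rule prod.neutral) (auto simp: inv_f_f[OF inj] w)
  also have "?R - ?X - ?g ` ?X = left_region m n c A"
  proof -
    have "?g ` ?X = ltri m c ` ({..<n + c} - A)" by (force simp: inv_f_f[OF inj])
    then have "?R - ?X - ?g ` ?X = left_region m n (Suc c) {} - rtri m c ` A - ?X - ltri m c ` ({..<n + c} - A)"
      by simp
    also have "\<dots> = left_region m n c A"
      using A(1) by (auto simp: less_Suc_eq elim!: mem_left_regionE)
    finally show ?thesis .
  qed
  finally show ?thesis by simp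
qed

text \<open>The region contains no triangle to the right of column \<open>Suc c\<close>, so the left
  triangle at \<open>a \<in> A\<close> is paired with edge \<open>a\<close> (down-step) or
  \<open>a - 1\<close> (up-step) of column \<open>c\<close>. Injectivity of the matching is the
  disjointness condition of \<open>valid_step\<close>; the conditions on 0 and on the top position
  say that the partner exists.\<close>

lemma tiling_sum_left_region_Suc:
  assumes A: "A \<subseteq> {..<Suc (n + c)}" "card A = n"
    and wh: "\<And>p. w {rtri m c p, ltri m c p} = 1"
    and wp: "\<And>p. w {ltri m (Suc c) (Suc p), rtri m c p} = 1"
    and wn: "\<And>p. w {ltri m (Suc c) p, rtri m c p} = s"
  shows "tiling_sum lozenge w (left_region m n (Suc c) A) =
    (\<Sum>U | valid_step (n + c) A U.
      s ^ card (A - U) * tiling_sum lozenge w (left_region m n c (step_back A U)))"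
proof -
  let ?R = "left_region m n (Suc c) A" and ?X = "ltri m (Suc c) ` A"
  let ?N = "n + c"
  define pos where "pos = inv_into UNIV (ltri m (Suc c))"
  have pos [simp]: "pos (ltri m (Suc c) a) = a" for a
    unfolding pos_def by (rule inv_f_f) (simp add: inj_def)
  define \<Phi> where "\<Phi> = (\<lambda>U. restrict (\<lambda>T. rtri m c (if pos T \<in> U then pos T - 1 else pos T)) ?X)"
  have finA: "finite A" using A(1) finite_subset by blast
  have \<Phi>: "\<Phi> U (ltri m (Suc c) a) = rtri m c (if a \<in> U then a - 1 else a)" if "a \<in> A" for U a
    using that by (simp add: \<Phi>_def)
  have \<Phi>_image: "\<Phi> U ` ?X = rtri m c ` step_back A U" if "U \<subseteq> A" for U
  proof -
    have "\<Phi> U ` ?X = (\<lambda>a. rtri m c (if a \<in> U then a - 1 else a)) ` A"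
      unfolding image_image by (rule image_cong) (simp_all add: \<Phi>)
    also have "\<dots> = rtri m c ` step_back A U" using that by (auto simp: step_back_def)
    finally show ?thesis .
  qed
  have matching: "\<phi> (ltri m (Suc c) a) = rtri m c a \<and> a < ?N \<or>
      \<phi> (ltri m (Suc c) a) = rtri m c (a - 1) \<and> a > 0"
    if "\<phi> \<in> matchings lozenge ?R ?X" "a \<in> A" for \<phi> a
  proof -
    have "\<phi> (ltri m (Suc c) a) \<in> {u \<in> ?R. lozenge {ltri m (Suc c) a, u}}"
      using that by (auto simp: matchings_def dest: PiE_mem)
    then obtain u where u: "\<phi> (ltri m (Suc c) a) = u" "u \<in> ?R" "lozenge {ltri m (Suc c) a, u}"
      by blast
    from u(2) show ?thesis
      by (rule mem_left_regionE) (use u(1,3) in auto)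
  qed
  have "tiling_sum lozenge w ?R =
    (\<Sum>\<phi>\<in>matchings lozenge ?R ?X. (\<Prod>x\<in>?X. w {x, \<phi> x}) * tiling_sum lozenge w (?R - ?X - \<phi> ` ?X))"
  proof (rule tiling_sum_peel_set)
    show "\<exists>u. u \<notin> ?X \<and> L = {x, u}" if L: "lozenge L" "x \<in> ?X" "x \<in> L" for L x
    proof -
      obtain p where "x = ltri m (Suc c) p" using L by auto
      then obtain y h where "L = {x, rt y h}" using lozenge_with_ltri L by blast
      then show ?thesis by (intro exI[of _ "rt y h"]) (auto simp: ltri_def)
    qed
  qed (use finA in \<open>auto simp: finite_left_region\<close>)
  also have "\<dots> = (\<Sum>U | valid_step ?N A U.
      s ^ card (A - U) * tiling_sum lozenge w (left_region m n c (step_back A U)))"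
  proof (rule sum.reindex_bij_witness[of _ \<Phi> "\<lambda>\<phi>. {a \<in> A. \<phi> (ltri m (Suc c) a) \<noteq> rtri m c a}"])
    fix \<phi> assume \<phi>: "\<phi> \<in> matchings lozenge ?R ?X"
    define U where "U = {a \<in> A. \<phi> (ltri m (Suc c) a) \<noteq> rtri m c a}"
    have inj\<phi>: "inj_on \<phi> ?X" using \<phi> by (simp add: matchings_def)
    have val: "\<phi> (ltri m (Suc c) a) = rtri m c (if a \<in> U then a - 1 else a)" if "a \<in> A" for a
      using matching[OF \<phi> that] that by (auto simp: U_def)
    show eq: "\<Phi> U = \<phi>"
    proof
      show "\<Phi> U T = \<phi> T" for T
      proof (cases "T \<in> ?X")
        case True
        then show ?thesis using val by (auto simp: \<Phi>)
      next
        case False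
        then have "\<phi> T = undefined" using \<phi> by (auto simp: matchings_def PiE_def extensional_def)
        then show ?thesis using False by (simp add: \<Phi>_def)
      qed
    qed
    have valid: "valid_step ?N A U"
      unfolding valid_step_def
    proof (intro conjI)
      show "U \<subseteq> A" by (auto simp: U_def)
      show "0 \<notin> U" using matching[OF \<phi>, of 0] by (auto simp: U_def)
      show "?N \<notin> A - U" using matching[OF \<phi>, of ?N] by (auto simp: U_def)
      show "(A - U) \<inter> (\<lambda>a. a - 1) ` U = {}"
      proof (rule equals0I)
        fix b assume "b \<in> (A - U) \<inter> (\<lambda>a. a - 1) ` U"
        then obtain a where a: "b \<in> A" "b \<notin> U" "a \<in> U" "b = a - 1" by auto
        then have "a \<in> A" by (auto simp: U_def)
        then have "\<phi> (ltri m (Suc c) a) = \<phi> (ltri m (Suc c) b)" using val a by simp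
        then have "ltri m (Suc c) a = ltri m (Suc c) b"
          by (rule inj_onD[OF inj\<phi>]) (use \<open>a \<in> A\<close> a in auto)
        then have "a = b" by simp
        then show False using a by simp
      qed
    qed
    then show "U \<in> {U. valid_step ?N A U}" by simp
    have "(\<Prod>x\<in>?X. w {x, \<phi> x}) = (\<Prod>a\<in>A. w {ltri m (Suc c) a, \<phi> (ltri m (Suc c) a)})"
      by (subst prod.reindex) (auto simp: inj_on_def)
    also have "\<dots> = (\<Prod>a\<in>A. if a \<in> U then 1 else s)"
    proof (rule prod.cong[OF refl])
      fix a assume a: "a \<in> A"
      show "w {ltri m (Suc c) a, \<phi> (ltri m (Suc c) a)} = (if a \<in> U then 1 else s)"
      proof (cases "a \<in> U")
        case True
        then obtain b where "a = Suc b" using valid by (cases a) (auto simp: valid_step_def)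
        then show ?thesis using True val[OF a] wp by simp
      next
        case False
        then show ?thesis using val[OF a] wn by simp
      qed
    qed
    also have "\<dots> = s ^ card (A - U)"
      using finA by (simp add: prod.If_cases Diff_eq)
    finally have prod: "(\<Prod>x\<in>?X. w {x, \<phi> x}) = s ^ card (A - U)" .
    have "?R - ?X - \<phi> ` ?X = left_region m n (Suc c) {} - rtri m c ` step_back A U"
      unfolding eq[symmetric] using \<Phi>_image[of U] valid
      by (auto simp: valid_step_def elim!: mem_left_regionE)
    moreover have "tiling_sum lozenge w (left_region m n (Suc c) {} - rtri m c ` step_back A U) =
      tiling_sum lozenge w (left_region m n c (step_back A U))"
      using step_back_subset[OF valid A(1)] card_step_back[OF valid A(1)] A(2) wh
      by (intro tiling_sum_forced_column) auto
    ultimately show "s ^ card (A - U) * tiling_sum lozenge w (left_region m n c (step_back A U)) =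
      (\<Prod>x\<in>?X. w {x, \<phi> x}) * tiling_sum lozenge w (?R - ?X - \<phi> ` ?X)"
      by (simp add: prod)
  next
    fix U assume "U \<in> {U. valid_step ?N A U}"
    then have U: "valid_step ?N A U" by simp
    then have sub: "U \<subseteq> A" and U0: "0 \<notin> U" by (auto simp: valid_step_def)
    have "\<Phi> U (ltri m (Suc c) a) \<noteq> rtri m c a \<longleftrightarrow> a \<in> U" if "a \<in> A" for a
      using that U0 by (cases a) (auto simp: \<Phi>)
    then show "{a \<in> A. \<Phi> U (ltri m (Suc c) a) \<noteq> rtri m c a} = U"
      using sub by auto
    show "\<Phi> U \<in> matchings lozenge ?R ?X"
      unfolding matchings_def
    proof (rule CollectI, rule conjI, rule PiE_I)
      fix T assume "T \<in> ?X"
      then obtain a where a: "a \<in> A" "T = ltri m (Suc c) a" by auto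
      have "(if a \<in> U then a - 1 else a) \<in> step_back A U"
        using a by (auto simp: step_back_def)
      then have "(if a \<in> U then a - 1 else a) < ?N"
        using step_back_subset[OF U A(1)] by blast
      then show "\<Phi> U T \<in> {u \<in> ?R. lozenge {T, u}}"
        using a U0 by (cases a) (auto simp: \<Phi>)
    next
      show "inj_on (\<Phi> U) ?X"
      \<comment> \<open>Injectivity by counting: the image corresponds to
        \<open>step_back A U\<close>, which has as many elements as \<open>A\<close>.\<close>
      proof (rule eq_card_imp_inj_on)
        show "finite ?X" using finA by simp
        have "card (\<Phi> U ` ?X) = card (step_back A U)"
          unfolding \<Phi>_image[OF sub] by (rule card_image) (simp add: inj_on_def)
        also have "\<dots> = card ?X"
          unfolding card_step_back[OF U A(1)] by (rule card_image[symmetric]) (simp add: inj_on_def)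
        finally show "card (\<Phi> U ` ?X) = card ?X" .
      qed
    qed (simp add: \<Phi>_def)
  qed
  finally show ?thesis .
qed

section \<open>Symmetric tilings\<close>

definition mirror :: "triangle \<Rightarrow> triangle" where
  "mirror T = reflect ` T"

lemma mirror_lt [simp]: "mirror (lt x h) = rt (- x) h"
  by (simp add: mirror_def lt_def rt_def reflect_def)

lemma mirror_rt [simp]: "mirror (rt x h) = lt (- x) h"
  by (simp add: mirror_def lt_def rt_def reflect_def)

lemma mirror_mirror [simp]: "mirror (mirror T) = T"
  by (simp add: mirror_def reflect_def image_image)

lemma inj_mirror: "inj_on mirror S"
  by (rule inj_on_inverseI[of _ mirror]) simp

lemma mem_mirror_image: "T \<in> mirror ` S \<longleftrightarrow> mirror T \<in> S"
  by (metis imageE image_eqI mirror_mirror)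

lemma mirror_image_mirror_image [simp]: "mirror ` mirror ` S = S"
  by (simp add: image_image)

lemma symmetric_tiling_iff: "symmetric_tiling \<tau> \<longleftrightarrow> (`) mirror ` \<tau> = \<tau>"
  by (simp add: symmetric_tiling_def mirror_def[abs_def])

lemma lozenge_mirror: "lozenge (mirror ` L)" if "lozenge L"
  using that by (rule lozenge_cases) (auto simp: insert_commute)

lemma lt_mem_hexagon: "lt x h \<in> hexagon (0, y) a a k \<longleftrightarrow>
    even (x + h) \<and> 1 - int a \<le> x \<and> x \<le> int a \<and> \<bar>x\<bar> \<le> h - y \<and>
    h - y + 2 + \<bar>x\<bar> \<le> 2 * (int a + int k)"
  by (auto simp: hexagon_def unit_triangles_eq Let_def) (auto simp: lt_def)

lemma rt_mem_hexagon: "rt x h \<in> hexagon (0, y) a a k \<longleftrightarrow>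
    even (x + h) \<and> - int a \<le> x \<and> x \<le> int a - 1 \<and> \<bar>x\<bar> \<le> h - y \<and>
    h - y + 2 + \<bar>x\<bar> \<le> 2 * (int a + int k)"
  by (auto simp: hexagon_def unit_triangles_eq Let_def) (auto simp: rt_def)

lemma column_position:
  assumes "even (x + h)" "- int m \<le> x" "- x \<le> h" "h + 2 - x \<le> 2 * (int m + int n)"
  obtains c p where "x = int c - int m" "h = int m - int c + 2 * int p" "p < n + c"
proof -
  define c p where "c = nat (x + int m)" and "p = nat ((h + x) div 2)"
  have "h + x = 2 * int p" using assms(1,3) by (simp add: p_def)
  moreover have "x = int c - int m" using assms(2) by (simp add: c_def)
  ultimately show thesis using assms(4) by (intro that[of c p]) auto
qed

lemma lt_mem_left_half: "lt x h \<in> left_region m n m {..<n + m} \<longleftrightarrow>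
    even (x + h) \<and> 1 - int m \<le> x \<and> x \<le> 0 \<and> - x \<le> h \<and> h + 2 - x \<le> 2 * (int m + int n)"
proof
  assume "lt x h \<in> left_region m n m {..<n + m}"
  then show "even (x + h) \<and> 1 - int m \<le> x \<and> x \<le> 0 \<and> - x \<le> h \<and>
      h + 2 - x \<le> 2 * (int m + int n)"
    by (rule mem_left_regionE) (auto simp: ltri_def rtri_def)
next
  assume *: "even (x + h) \<and> 1 - int m \<le> x \<and> x \<le> 0 \<and> - x \<le> h \<and>
      h + 2 - x \<le> 2 * (int m + int n)"
  then obtain c p where cp: "x = int c - int m" "h = int m - int c + 2 * int p" "p < n + c"
    using column_position[of x h m n] by (smt (verit))
  then have "lt x h = ltri m c p" by (simp add: ltri_def)
  then show "lt x h \<in> left_region m n m {..<n + m}" using cp * by (simp, linarith)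
qed

lemma rt_mem_left_half: "rt x h \<in> left_region m n m {..<n + m} \<longleftrightarrow>
    even (x + h) \<and> - int m \<le> x \<and> x < 0 \<and> - x \<le> h \<and> h + 2 - x \<le> 2 * (int m + int n)"
proof
  assume "rt x h \<in> left_region m n m {..<n + m}"
  then show "even (x + h) \<and> - int m \<le> x \<and> x < 0 \<and> - x \<le> h \<and>
      h + 2 - x \<le> 2 * (int m + int n)"
    by (rule mem_left_regionE) (auto simp: ltri_def rtri_def)
next
  assume *: "even (x + h) \<and> - int m \<le> x \<and> x < 0 \<and> - x \<le> h \<and>
      h + 2 - x \<le> 2 * (int m + int n)"
  then obtain c p where cp: "x = int c - int m" "h = int m - int c + 2 * int p" "p < n + c"
    using column_position[of x h m n] by (smt (verit))
  then have "rt x h = rtri m c p" by (simp add: rtri_def)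
  then show "rt x h \<in> left_region m n m {..<n + m}" using cp * by simp
qed

lemma hexagon_eq_left_half_mirror: "hexagon (0, 0) m m n =
    left_region m n m {..<n + m} \<union> mirror ` left_region m n m {..<n + m}" (is "?H = ?K \<union> _")
proof (rule Set.set_eqI)
  fix T :: triangle
  have lt: "lt x h \<in> ?H \<longleftrightarrow> lt x h \<in> ?K \<union> mirror ` ?K" for x h
    by (auto simp: lt_mem_hexagon lt_mem_left_half rt_mem_left_half mem_mirror_image)
  have rt: "rt x h \<in> ?H \<longleftrightarrow> rt x h \<in> ?K \<union> mirror ` ?K" for x h
    by (auto simp: rt_mem_hexagon lt_mem_left_half rt_mem_left_half mem_mirror_image)
  have shape: "\<exists>x h. T = lt x h \<or> T = rt x h" if "T \<in> ?K" for T
    using that by (auto elim!: mem_left_regionE simp: ltri_def rtri_def)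
  show "T \<in> ?H \<longleftrightarrow> T \<in> ?K \<union> mirror ` ?K"
  proof
    assume "T \<in> ?H"
    then have "\<exists>x h. T = lt x h \<or> T = rt x h" by (auto simp: hexagon_def unit_triangles_eq)
    then show "T \<in> ?K \<union> mirror ` ?K" using \<open>T \<in> ?H\<close> lt rt by metis
  next
    assume *: "T \<in> ?K \<union> mirror ` ?K"
    then consider "T \<in> ?K" | T' where "T' \<in> ?K" "T = mirror T'" by auto
    then have "\<exists>x h. T = lt x h \<or> T = rt x h" by cases (use shape in force)+
    then show "T \<in> ?H" using * lt rt by metis
  qed
qed

lemma left_half_Int_mirror: "T \<in> left_region m n m {..<n + m} \<Longrightarrow>
    mirror T \<notin> left_region m n m {..<n + m}"
  by (erule mem_left_regionE)
    (auto simp: ltri_def rtri_def lt_mem_left_half rt_mem_left_half)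

section \<open>Lozenges beside and across the diagonal\<close>

definition axis_lozenge :: "nat \<Rightarrow> nat \<Rightarrow> region" where
  "axis_lozenge m p = {ltri m m p, rtri m m p}"

lemma lozenge_axis [simp]: "lozenge (axis_lozenge m p)"
  by (simp add: axis_lozenge_def)

lemma mirror_ltri_axis [simp]: "mirror (ltri m m p) = rtri m m p"
  and mirror_rtri_axis [simp]: "mirror (rtri m m p) = ltri m m p"
  by (simp_all add: ltri_def rtri_def)

lemma mirror_axis_lozenge [simp]: "mirror ` axis_lozenge m p = axis_lozenge m p"
  by (auto simp: axis_lozenge_def)

lemma axis_lozenge_eq_iff [simp]: "axis_lozenge m p = axis_lozenge m p' \<longleftrightarrow> p = p'"
  by (auto simp: axis_lozenge_def doubleton_eq_iff)

text \<open>The vertical edges of the two triangles lie in the same column or in adjacent ones. If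
  one of them is off the diagonal, its side determines that of the whole lozenge; otherwise both
  triangles share an edge of the diagonal.\<close>

lemma lozenge_in_hexagon_cases:
  assumes "lozenge L" "L \<subseteq> hexagon (0, 0) m m n"
  obtains "L \<subseteq> left_region m n m {..<n + m}"
    | "mirror ` L \<subseteq> left_region m n m {..<n + m}"
    | p where "p < n + m" "L = axis_lozenge m p"
proof -
  let ?K = "left_region m n m {..<n + m}"
  have sub: "T \<in> ?K \<or> mirror T \<in> ?K" if "T \<in> L" for T
    using assms(2) that unfolding hexagon_eq_left_half_mirror by (auto simp: mem_mirror_image)
  obtain x h x' h' where L: "L = {lt x h, rt x' h'}" "even (x + h)"
    "x' = x \<and> h' = h \<or> x' = x - 1 \<and> (h' = h - 1 \<or> h' = h + 1)"
    using assms(1) by (rule lozenge_cases) blast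
  have lt: "lt x h \<in> ?K \<or> rt (- x) h \<in> ?K" and rt: "rt x' h' \<in> ?K \<or> lt (- x') h' \<in> ?K"
    using sub[of "lt x h"] sub[of "rt x' h'"] L by auto
  consider "x' < 0" | "x > 0" | "x = 0" "x' = 0" "h' = h" using L(3) by linarith
  then show thesis
  proof cases
    case 1
    then have "x \<le> 0" using L(3) by linarith
    then have "L \<subseteq> ?K"
      using 1 lt rt L(1) by (auto simp: rt_mem_left_half lt_mem_left_half)
    then show thesis by (rule that(1))
  next
    case 2
    then have "x' \<ge> 0" using L(3) by linarith
    then have "mirror ` L \<subseteq> ?K"
      using 2 lt rt L(1) by (auto simp: rt_mem_left_half lt_mem_left_half)
    then show thesis by (rule that(2))
  next
    case 3
    then have "lt 0 h \<in> ?K" using lt by (auto simp: rt_mem_left_half)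
    then have "even h" "h \<ge> 0" "h + 2 \<le> 2 * (int m + int n)" by (auto simp: lt_mem_left_half)
    moreover from this obtain p where "h = 2 * int p" by (metis dvd_def nonneg_int_cases zero_le_mult_iff
        zero_less_numeral not_less order_less_le_trans)
    ultimately have "p < n + m" "L = axis_lozenge m p"
      using 3 L by (auto simp: axis_lozenge_def ltri_def rtri_def)
    then show thesis by (rule that(3))
  qed
qed

lemma left_of_diagonal_iff:
  assumes "lozenge L" "L \<subseteq> hexagon (0, 0) m m n"
  shows "left_of_diagonal L \<longleftrightarrow> L \<subseteq> left_region m n m {..<n + m}"
proof
  have K: "fst v \<le> 0" if "T \<in> left_region m n m {..<n + m}" "v \<in> T" for T v
    using that by (auto elim!: mem_left_regionE simp: ltri_def rtri_def lt_def rt_def)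
  then show "left_of_diagonal L" if "L \<subseteq> left_region m n m {..<n + m}"
    using that by (auto simp: left_of_diagonal_def)
  have right: "\<exists>v\<in>T. fst v > 0" if "mirror T \<in> left_region m n m {..<n + m}" for T
    using that
  proof (rule mem_left_regionE)
    fix c p assume "mirror T = ltri m c p" "c < m \<and> p < n + c \<or> c = m \<and> p \<in> {..<n + m}"
    moreover from this have "T = mirror (ltri m c p)" by (metis mirror_mirror)
    ultimately show ?thesis by (auto simp: ltri_def rt_def)
  next
    fix c p assume "mirror T = rtri m c p" "c < m"
    moreover from this have "T = mirror (rtri m c p)" by (metis mirror_mirror)
    ultimately show ?thesis by (auto simp: rtri_def lt_def)
  qed
  assume l: "left_of_diagonal L"
  show "L \<subseteq> left_region m n m {..<n + m}"
    using assms
  proof (rule lozenge_in_hexagon_cases)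
    assume *: "mirror ` L \<subseteq> left_region m n m {..<n + m}"
    obtain T where "T \<in> L" using assms(1) by (auto simp: lozenge_def)
    then obtain v where "v \<in> T" "fst v > 0" using right[of T] * by blast
    then show ?thesis using \<open>T \<in> L\<close> l by (fastforce simp: left_of_diagonal_def)
  next
    fix p assume "L = axis_lozenge m p"
    then have "rt 0 (2 * int p) \<in> L" by (auto simp: axis_lozenge_def rtri_def)
    moreover have "(1, 2 * int p + 1) \<in> rt 0 (2 * int p)" by (simp add: rt_def)
    ultimately have "fst (1::int, 2 * int p + 1) \<le> 0"
      using l unfolding left_of_diagonal_def by (meson UnionI)
    then show ?thesis by simp
  qed
qed


definition cell_edges :: "(nat \<Rightarrow> nat) \<Rightarrow> nat \<Rightarrow> nat set" where
  "cell_edges r i = {(\<Sum>j\<in>{1..<i}. r j + 1)..(\<Sum>j\<in>{1..<i}. r j + 1) + r i}"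

text \<open>A cell reaches only one column to either side of the diagonal, so a horizontal lozenge
  inside it has its short diagonal on \<open>x = 0\<close>. The choice of \<open>m\<close> is free
  because column \<open>m\<close> is always the line \<open>x = 0\<close>.\<close>

lemma horizontal_in_cell_iff:
  "horizontal L \<and> L \<subseteq> cell r i \<longleftrightarrow> (\<exists>p\<in>cell_edges r i. L = axis_lozenge m p)"
proof
  assume *: "horizontal L \<and> L \<subseteq> cell r i"
  then have "lozenge L" by (simp add: horizontal_def)
  then obtain x h x' h' where "even (x + h)" "L = {lt x h, rt x' h'}"
    by (rule lozenge_cases) blast
  with * have L: "L = {lt x h, rt x h}" "even (x + h)" by auto
  define b where "b = (\<Sum>j\<in>{1..<i}. r j + 1)"
  have "lt x h \<in> hexagon (0, 2 * int b) 1 1 (r i)" "rt x h \<in> hexagon (0, 2 * int b) 1 1 (r i)"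
    using * L by (auto simp: cell_def b_def)
  then have "x = 0" and h: "2 * int b \<le> h" "h \<le> 2 * (int b + int (r i))"
    by (auto simp: lt_mem_hexagon rt_mem_hexagon)
  then obtain k where k: "h = 2 * k" using L by auto
  then have "h = 2 * int (nat k)" "nat k \<in> {b..b + r i}" using h by auto
  then show "\<exists>p\<in>cell_edges r i. L = axis_lozenge m p"
    using L \<open>x = 0\<close> unfolding cell_edges_def b_def[symmetric]
    by (intro bexI[of _ "nat k"]) (auto simp: axis_lozenge_def ltri_def rtri_def)
next
  assume "\<exists>p\<in>cell_edges r i. L = axis_lozenge m p"
  then obtain p where p: "p \<in> cell_edges r i" "L = axis_lozenge m p" by auto
  then have L: "L = {lt 0 (2 * int p), rt 0 (2 * int p)}"
    by (simp add: axis_lozenge_def ltri_def rtri_def)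
  define b where "b = (\<Sum>j\<in>{1..<i}. r j + 1)"
  have "b \<le> p" "p \<le> b + r i" using p unfolding cell_edges_def b_def by auto
  then have "L \<subseteq> cell r i"
    unfolding cell_def b_def[symmetric] by (auto simp: L lt_mem_hexagon rt_mem_hexagon)
  then show "horizontal L \<and> L \<subseteq> cell r i" by (simp add: L)
qed

text \<open>The vertical diagonal of the cell has \<open>r i + 1\<close> edges, so
  \<open>r i\<close> horizontal lozenges leave exactly one edge uncrossed.\<close>

lemma card_horizontal_in_cell_iff:
  assumes "cell_edges r i \<subseteq> {..<n + m}"
  shows "card {L \<in> \<tau>. horizontal L \<and> L \<subseteq> cell r i} = r i \<longleftrightarrow>
    card ({p \<in> {..<n + m}. axis_lozenge m p \<notin> \<tau>} \<inter> cell_edges r i) = 1"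
proof -
  let ?P = "{p \<in> cell_edges r i. axis_lozenge m p \<in> \<tau>}"
  have fin: "finite (cell_edges r i)" and card: "card (cell_edges r i) = Suc (r i)"
    by (simp_all add: cell_edges_def)
  have "{L \<in> \<tau>. horizontal L \<and> L \<subseteq> cell r i} = axis_lozenge m ` ?P"
    by (auto simp: horizontal_in_cell_iff[of _ _ _ m])
  moreover have "inj_on (axis_lozenge m) ?P" by (auto simp: inj_on_def)
  ultimately have hor: "card {L \<in> \<tau>. horizontal L \<and> L \<subseteq> cell r i} = card ?P"
    by (simp add: card_image)
  have "{p \<in> {..<n + m}. axis_lozenge m p \<notin> \<tau>} \<inter> cell_edges r i = cell_edges r i - ?P"
    using assms by auto
  moreover have "card (cell_edges r i - ?P) = Suc (r i) - card ?P"
    using fin card by (subst card_Diff_subset) auto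
  moreover have "card ?P \<le> Suc (r i)"
    unfolding card[symmetric] using fin by (intro card_mono) auto
  ultimately show ?thesis unfolding hor by (simp only:) linarith
qed

text \<open>The inverse of cutting a symmetric tiling along the diagonal; \<open>A\<close> lists the
  edges of the diagonal that no horizontal lozenge crosses.\<close>

definition glue :: "nat \<Rightarrow> nat \<Rightarrow> nat set \<Rightarrow> region set \<Rightarrow> region set" where
  "glue m n A \<sigma> = \<sigma> \<union> (`) mirror ` \<sigma> \<union> axis_lozenge m ` ({..<n + m} - A)"

lemma left_half_split:
  assumes "m > 0" "A \<subseteq> {..<n + m}"
  shows "left_region m n m {..<n + m} = left_region m n m A \<union> ltri m m ` ({..<n + m} - A)"
    and "left_region m n m A \<inter> ltri m m ` ({..<n + m} - A) = {}"
  using assms by (auto simp: left_region_def)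

context
  fixes m n :: nat and A :: "nat set" and \<sigma> :: "region set"
  assumes m: "m > 0" and A: "A \<subseteq> {..<n + m}"
    and \<sigma>: "\<sigma> \<in> tilings lozenge (left_region m n m A)"
begin

private lemma \<sigma>_partition: "\<Union>\<sigma> = left_region m n m A" "disjoint \<sigma>" "{} \<notin> \<sigma>" "\<And>L. L \<in> \<sigma> \<Longrightarrow> lozenge L"
  using \<sigma> by (auto simp: tilings_def partition_on_def)

private lemma \<sigma>_subset: "\<Union>\<sigma> \<subseteq> left_region m n m {..<n + m}"
  using left_half_split(1)[OF m A] \<sigma>_partition(1) by blast

private lemma Union_mirror: "\<Union>((`) mirror ` \<sigma>) = mirror ` left_region m n m A"
  unfolding \<sigma>_partition(1)[symmetric] by blast

private lemma Union_axis: "\<Union>(axis_lozenge m ` ({..<n + m} - A)) =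
    ltri m m ` ({..<n + m} - A) \<union> mirror ` ltri m m ` ({..<n + m} - A)"
  unfolding image_image mirror_ltri_axis by (auto simp: axis_lozenge_def)

lemma axis_lozenge_mem_glue_iff: "axis_lozenge m p \<in> glue m n A \<sigma> \<longleftrightarrow> p < n + m \<and> p \<notin> A"
proof -
  have *: "rtri m m p \<notin> left_region m n m {..<n + m}" by simp
  then have "axis_lozenge m p \<notin> \<sigma>"
    using \<sigma>_subset by (auto simp: axis_lozenge_def)
  moreover have "axis_lozenge m p \<notin> (`) mirror ` \<sigma>"
  proof
    assume "axis_lozenge m p \<in> (`) mirror ` \<sigma>"
    then obtain L where "L \<in> \<sigma>" "axis_lozenge m p = mirror ` L" by auto
    then have "mirror ` axis_lozenge m p \<in> \<sigma>" by simp
    then show False using \<open>axis_lozenge m p \<notin> \<sigma>\<close> by simp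
  qed
  ultimately show ?thesis by (auto simp: glue_def)
qed

lemma glue_tiling: "lozenge_tiling (hexagon (0, 0) m m n) (glue m n A \<sigma>)"
  unfolding lozenge_tiling_def
proof (intro conjI ballI partition_onI)
  let ?K = "left_region m n m {..<n + m}"
  have KM: "?K \<inter> mirror ` ?K = {}"
    using left_half_Int_mirror by (auto simp: mem_mirror_image)
  note split = left_half_split[OF m A]
  show "\<Union>(glue m n A \<sigma>) = hexagon (0, 0) m m n"
    unfolding hexagon_eq_left_half_mirror glue_def Union_Un_distrib Union_mirror Union_axis
      \<sigma>_partition(1) split(1) by blast
  have dj: "disjoint (axis_lozenge m ` ({..<n + m} - A))"
    by (auto simp: disjoint_def axis_lozenge_def)
  have dm: "disjoint ((`) mirror ` \<sigma>)"
    by (rule disjoint_image[OF inj_mirror \<sigma>_partition(2)])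
  have i1: "\<Union>\<sigma> \<inter> \<Union>((`) mirror ` \<sigma>) = {}"
    using KM \<sigma>_subset by blast
  have inj: "mirror ` X \<inter> mirror ` Y = mirror ` (X \<inter> Y)" for X Y
    by (rule image_Int[symmetric, OF inj_mirror])
  have i2: "\<Union>(\<sigma> \<union> (`) mirror ` \<sigma>) \<inter> \<Union>(axis_lozenge m ` ({..<n + m} - A)) = {}"
  proof -
    let ?B = "ltri m m ` ({..<n + m} - A)" and ?L = "left_region m n m A"
    have "?L \<inter> mirror ` ?B = {}" "mirror ` ?L \<inter> ?B = {}" "mirror ` ?L \<inter> mirror ` ?B = {}"
      using KM split unfolding inj by blast+
    then show ?thesis
      unfolding Union_Un_distrib Union_mirror Union_axis \<sigma>_partition(1) using split(2) by blast
  qed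
  have dg: "disjoint (glue m n A \<sigma>)"
    unfolding glue_def
    by (rule disjoint_union[OF disjoint_union[OF \<sigma>_partition(2) dm i1] dj i2])
  show "disjnt X Y" if "X \<in> glue m n A \<sigma>" "Y \<in> glue m n A \<sigma>" "X \<noteq> Y" for X Y
    using disjointD[OF dg that] by (simp add: disjnt_def)
  show loz: "lozenge L" if "L \<in> glue m n A \<sigma>" for L
    using that \<sigma>_partition(4) by (auto simp: glue_def lozenge_mirror)
  show "{} \<notin> glue m n A \<sigma>"
    using loz[of "{}"] by (auto simp: lozenge_def)
qed

lemma glue_symmetric: "symmetric_tiling (glue m n A \<sigma>)"
  by (auto simp: symmetric_tiling_iff glue_def image_Un image_image)

lemma glue_left: "{L \<in> glue m n A \<sigma>. left_of_diagonal L} = \<sigma>"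
proof -
  let ?K = "left_region m n m {..<n + m}"
  have left: "left_of_diagonal L \<longleftrightarrow> L \<subseteq> ?K" if "L \<in> glue m n A \<sigma>" for L
    using glue_tiling that
    by (intro left_of_diagonal_iff) (auto simp: lozenge_tiling_def partition_on_def)
  have not_mirror: "\<not> mirror ` L \<subseteq> ?K" if L: "L \<in> \<sigma>" for L
  proof -
    obtain T where "T \<in> L" using \<sigma>_partition(3) L by fastforce
    then have "T \<in> ?K" using \<sigma>_subset L by blast
    then show ?thesis using left_half_Int_mirror \<open>T \<in> L\<close> by blast
  qed
  show ?thesis
  proof (intro subset_antisym subsetI)
    fix L assume "L \<in> {L \<in> glue m n A \<sigma>. left_of_diagonal L}"
    then have L: "L \<in> glue m n A \<sigma>" "L \<subseteq> ?K" using left by blast+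
    from L(1) consider "L \<in> \<sigma>" | L' where "L' \<in> \<sigma>" "L = mirror ` L'" | p where "L = axis_lozenge m p"
      unfolding glue_def by blast
    then show "L \<in> \<sigma>"
    proof cases
      case 2
      then show ?thesis using not_mirror[of L'] L(2) by simp
    next
      case 3
      then show ?thesis using L(2) by (simp add: axis_lozenge_def)
    qed
  next
    fix L assume L: "L \<in> \<sigma>"
    then have "L \<in> glue m n A \<sigma>" "L \<subseteq> ?K" using \<sigma>_subset by (auto simp: glue_def)
    then show "L \<in> {L \<in> glue m n A \<sigma>. left_of_diagonal L}" using left by blast
  qed
qed

end

text \<open>A lozenge that does not cross the diagonal lies in one half, and symmetry makes the
  right half of the tiling the mirror image of the left one. Hence \<open>A\<close> and the left
  lozenges recover everything.\<close>

lemma symmetric_tiling_decomposition: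
  assumes m: "m > 0" and \<tau>: "lozenge_tiling (hexagon (0, 0) m m n) \<tau>" and "symmetric_tiling \<tau>"
  defines "A \<equiv> {p \<in> {..<n + m}. axis_lozenge m p \<notin> \<tau>}"
    and "\<sigma> \<equiv> {L \<in> \<tau>. left_of_diagonal L}"
  shows "\<sigma> \<in> tilings lozenge (left_region m n m A)" and "glue m n A \<sigma> = \<tau>"
proof -
  let ?K = "left_region m n m {..<n + m}"
  have A: "A \<subseteq> {..<n + m}" by (auto simp: A_def)
  have part: "\<Union>\<tau> = hexagon (0, 0) m m n" "disjoint \<tau>" "{} \<notin> \<tau>"
    using \<tau> by (auto simp: lozenge_tiling_def partition_on_def)
  have loz: "lozenge L" and sub: "L \<subseteq> hexagon (0, 0) m m n" if "L \<in> \<tau>" for L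
    using \<tau> that by (auto simp: lozenge_tiling_def partition_on_def)
  have \<sigma>: "\<sigma> = {L \<in> \<tau>. L \<subseteq> ?K}"
    unfolding \<sigma>_def using left_of_diagonal_iff[OF loz sub] by blast
  have mirror: "mirror ` L \<in> \<tau>" if "L \<in> \<tau>" for L
    using assms(3) that unfolding symmetric_tiling_iff by blast
  have "\<Union>\<sigma> = left_region m n m A"
  proof (intro subset_antisym subsetI)
    fix T assume "T \<in> \<Union>\<sigma>"
    then obtain L where L: "L \<in> \<tau>" "L \<subseteq> ?K" "T \<in> L" by (auto simp: \<sigma>)
    have "T \<notin> ltri m m ` ({..<n + m} - A)"
    proof
      assume "T \<in> ltri m m ` ({..<n + m} - A)"
      then obtain p where p: "T = ltri m m p" "axis_lozenge m p \<in> \<tau>" by (auto simp: A_def)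
      then have "T \<in> axis_lozenge m p" by (simp add: axis_lozenge_def)
      then have "axis_lozenge m p = L" using part(2) p L by (auto simp: disjoint_def)
      then have "axis_lozenge m p \<subseteq> ?K" using L(2) by simp
      then show False by (simp add: axis_lozenge_def)
    qed
    then show "T \<in> left_region m n m A" using L left_half_split(1)[OF m A] by blast
  next
    fix T assume T: "T \<in> left_region m n m A"
    then have TK: "T \<in> ?K" using left_half_split(1)[OF m A] by blast
    then have "T \<in> \<Union>\<tau>" using part(1) by (auto simp: hexagon_eq_left_half_mirror)
    then obtain L where L: "L \<in> \<tau>" "T \<in> L" by blast
    from loz[OF L(1)] sub[OF L(1)] show "T \<in> \<Union>\<sigma>"
    proof (rule lozenge_in_hexagon_cases)
      assume "mirror ` L \<subseteq> ?K"
      then show ?thesis using left_half_Int_mirror[OF TK] L(2) by blast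
    next
      fix p assume p: "L = axis_lozenge m p"
      then have "T = ltri m m p" using TK L by (auto simp: axis_lozenge_def)
      then show ?thesis using T L p by (auto simp: A_def)
    qed (use L in \<open>auto simp: \<sigma>\<close>)
  qed
  moreover have "disjoint \<sigma>" "{} \<notin> \<sigma>" using part(2,3) by (auto simp: \<sigma>_def disjoint_def)
  ultimately show "\<sigma> \<in> tilings lozenge (left_region m n m A)"
    using loz by (auto simp: tilings_def partition_on_def \<sigma>_def)
  show "glue m n A \<sigma> = \<tau>"
  proof (intro subset_antisym subsetI)
    fix L assume "L \<in> glue m n A \<sigma>"
    then show "L \<in> \<tau>" using mirror by (auto simp: glue_def \<sigma>_def A_def)
  next
    fix L assume L: "L \<in> \<tau>"
    from loz[OF L] sub[OF L] show "L \<in> glue m n A \<sigma>"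
    proof (rule lozenge_in_hexagon_cases)
      assume "mirror ` L \<subseteq> ?K"
      then have "mirror ` L \<in> \<sigma>" using mirror[OF L] by (simp add: \<sigma>)
      moreover have "L = mirror ` mirror ` L" by simp
      ultimately show ?thesis unfolding glue_def by blast
    next
      fix p assume "p < n + m" "L = axis_lozenge m p"
      then show ?thesis using L by (auto simp: glue_def A_def)
    qed (use L in \<open>auto simp: glue_def \<sigma>\<close>)
  qed
qed

text \<open>Under the correspondence of tilings with pairs \<open>(A, \<sigma>)\<close>, the cell
  condition concerns only \<open>A\<close> and the weight only \<open>\<sigma>\<close>.\<close>

lemma M_qt_eq_sum_tiling_sum:
  assumes m: "m > 0" and cells: "\<And>i. i \<in> {1..n} \<Longrightarrow> cell_edges r i \<subseteq> {..<n + m}"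
  shows "M_qt q t m n r =
    (\<Sum>A | A \<subseteq> {..<n + m} \<and> (\<forall>i\<in>{1..n}. card (A \<inter> cell_edges r i) = 1).
      tiling_sum lozenge (lozenge_weight q t) (left_region m n m A))"
proof -
  let ?\<A> = "{A. A \<subseteq> {..<n + m} \<and> (\<forall>i\<in>{1..n}. card (A \<inter> cell_edges r i) = 1)}"
  let ?T = "\<lambda>A. tilings lozenge (left_region m n m A)"
  let ?axis = "\<lambda>\<tau>. {p \<in> {..<n + m}. axis_lozenge m p \<notin> \<tau>}"
  have axis_glue: "?axis (glue m n A \<sigma>) = A" if "A \<subseteq> {..<n + m}" "\<sigma> \<in> ?T A" for A \<sigma>
    using that axis_lozenge_mem_glue_iff[OF m that] by auto
  have "M_qt q t m n r = (\<Sum>(A, \<sigma>)\<in>Sigma ?\<A> ?T. \<Prod>L\<in>\<sigma>. lozenge_weight q t L)"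
    unfolding M_qt_def
  proof (rule sum.reindex_bij_witness[of _ "\<lambda>(A, \<sigma>). glue m n A \<sigma>"
        "\<lambda>\<tau>. (?axis \<tau>, {L \<in> \<tau>. left_of_diagonal L})"])
    fix \<tau> assume "\<tau> \<in> block_diag_symmetric_tilings m n r"
    then have \<tau>: "lozenge_tiling (hexagon (0, 0) m m n) \<tau>" "symmetric_tiling \<tau>"
      and c: "\<forall>i\<in>{1..n}. card {L \<in> \<tau>. horizontal L \<and> L \<subseteq> cell r i} = r i"
      by (auto simp: block_diag_symmetric_tilings_def)
    note dec = symmetric_tiling_decomposition[OF m \<tau>]
    show "(case (?axis \<tau>, {L \<in> \<tau>. left_of_diagonal L}) of (A, \<sigma>) \<Rightarrow> glue m n A \<sigma>) = \<tau>"
      using dec(2) by simp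
    show "(?axis \<tau>, {L \<in> \<tau>. left_of_diagonal L}) \<in> Sigma ?\<A> ?T"
      using dec(1) c card_horizontal_in_cell_iff[OF cells] by (intro SigmaI) auto
    show "(case (?axis \<tau>, {L \<in> \<tau>. left_of_diagonal L}) of (A, \<sigma>) \<Rightarrow>
        \<Prod>L\<in>\<sigma>. lozenge_weight q t L) = tiling_weight q t \<tau>"
      by (simp add: tiling_weight_def)
  next
    fix z assume "z \<in> Sigma ?\<A> ?T"
    then obtain A \<sigma> where z: "z = (A, \<sigma>)" "A \<subseteq> {..<n + m}" "\<sigma> \<in> ?T A"
      and c: "\<forall>i\<in>{1..n}. card (A \<inter> cell_edges r i) = 1" by auto
    show "(?axis (case z of (A, \<sigma>) \<Rightarrow> glue m n A \<sigma>),
        {L \<in> (case z of (A, \<sigma>) \<Rightarrow> glue m n A \<sigma>). left_of_diagonal L}) = z"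
      using axis_glue[OF z(2,3)] glue_left[OF m z(2,3)] by (simp only: z(1) split)
    show "(case z of (A, \<sigma>) \<Rightarrow> glue m n A \<sigma>) \<in> block_diag_symmetric_tilings m n r"
      unfolding block_diag_symmetric_tilings_def z(1) split
    proof (intro CollectI conjI ballI)
      fix i assume i: "i \<in> {1..n}"
      show "card {L \<in> glue m n A \<sigma>. horizontal L \<and> L \<subseteq> cell r i} = r i"
        unfolding card_horizontal_in_cell_iff[OF cells[OF i]] axis_glue[OF z(2,3)]
        using c i by blast
    qed (rule glue_tiling[OF m z(2,3)] glue_symmetric[OF m z(2,3)])+
  qed
  also have "\<dots> = (\<Sum>A\<in>?\<A>. tiling_sum lozenge (lozenge_weight q t) (left_region m n m A))"
    unfolding tiling_sum_def
  proof (rule sum.Sigma[symmetric])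
    show "finite ?\<A>" by (rule finite_subset[of _ "Pow {..<n + m}"]) auto
    show "\<forall>A\<in>?\<A>. finite (?T A)"
      by (auto intro!: finite_tilings finite_left_region dest: finite_subset[OF _ finite_lessThan])
  qed
  finally show ?thesis .
qed

section \<open>The product formula\<close>

lemma qint_eq_sum: "q \<noteq> 1 \<Longrightarrow> qint q k = (\<Sum>i<k. q ^ i)"
  by (simp add: qint_def one_diff_power_eq)

lemma qfact_Suc: "qfact q (Suc k) = qint q (Suc k) * qfact q k"
  by (simp add: qfact_def)

text \<open>Excluding roots of unity, and 1 among them, keeps numerator and denominator of
  \<open>qint q i\<close> nonzero for \<open>i > 0\<close>.\<close>

lemma qfact_nonzero:
  assumes "\<And>k. k > 0 \<Longrightarrow> q ^ k \<noteq> 1"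
  shows "qfact q k \<noteq> 0"
  using assms[of 1] assms by (auto simp: qfact_def qint_def)

lemma diff_power_eq_qint:
  assumes "q \<noteq> 1" "a \<le> b"
  shows "q ^ b - q ^ a = q ^ a * ((q - 1) * qint q (b - a))"
proof -
  have "(q - 1) * qint q (b - a) = q ^ (b - a) - 1"
    using assms(1) by (simp add: qint_def field_simps)
  then show ?thesis
    using assms(2) by (simp add: right_diff_distrib power_add[symmetric])
qed

lemma prod_diff_below:
  assumes "q \<noteq> 1"
  shows "(\<Prod>b<a. q ^ a - q ^ b) = q ^ (a choose 2) * (q - 1) ^ a * qfact q a"
proof (induction a)
  case 0
  then show ?case by (simp add: qfact_def numeral_2_eq_2)
next
  case (Suc a)
  have "(\<Prod>b<Suc a. q ^ Suc a - q ^ b) = (q ^ Suc a - q ^ 0) * (\<Prod>b<a. q * (q ^ a - q ^ b))"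
    by (subst prod.lessThan_Suc_shift) (simp add: right_diff_distrib)
  also have "\<dots> = (q - 1) * qint q (Suc a) * (q ^ a * (\<Prod>b<a. q ^ a - q ^ b))"
    unfolding diff_power_eq_qint[OF assms le0] by (simp add: prod.distrib)
  also have "\<dots> = q ^ (Suc a choose 2) * (q - 1) ^ Suc a * qfact q (Suc a)"
    unfolding Suc.IH by (simp add: qfact_Suc numeral_2_eq_2 power_add mult_ac)
  finally show ?case .
qed

lemma prod_diff_above:
  assumes "q \<noteq> 1"
  shows "(\<Prod>j<k. q ^ (Suc a + j) - q ^ a) = q ^ (a * k) * (q - 1) ^ k * qfact q k"
proof (induction k)
  case 0
  then show ?case by (simp add: qfact_def)
next
  case (Suc k)
  have "q ^ (Suc a + k) - q ^ a = q ^ a * ((q - 1) * qint q (Suc k))"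
    using diff_power_eq_qint[OF assms, of a "Suc a + k"] by (simp add: Suc_diff_le)
  then show ?case
    using Suc.IH by (simp add: qfact_Suc power_add mult_ac del: power_Suc add_Suc) simp
qed

lemma qdists_eq_qfact:
  assumes "q \<noteq> 1"
  shows "qdists q (Suc (a + k)) a =
    q ^ ((a choose 2) + a * k) * (q - 1) ^ (a + k) * (qfact q a * qfact q k)"
proof -
  have "{..<Suc (a + k)} - {a} = {..<a} \<union> (\<lambda>j. Suc a + j) ` {..<k}"
  proof (intro subset_antisym subsetI)
    fix x assume "x \<in> {..<Suc (a + k)} - {a}"
    then show "x \<in> {..<a} \<union> (\<lambda>j. Suc a + j) ` {..<k}"
      by (cases "x < a") (auto intro!: image_eqI[of _ _ "x - Suc a"])
  qed auto
  then have "qdists q (Suc (a + k)) a = (\<Prod>b\<in>{..<a} \<union> (\<lambda>j. Suc a + j) ` {..<k}. qdist q a b)"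
    unfolding qdists_def by (simp only:)
  also have "\<dots> = (\<Prod>b<a. qdist q a b) * (\<Prod>b\<in>(\<lambda>j. Suc a + j) ` {..<k}. qdist q a b)"
    by (rule prod.union_disjoint) auto
  also have "(\<Prod>b\<in>(\<lambda>j. Suc a + j) ` {..<k}. qdist q a b) = (\<Prod>j<k. qdist q a (Suc a + j))"
    by (subst prod.reindex) (auto simp: inj_on_def)
  also have "(\<Prod>b<a. qdist q a b) = (\<Prod>b<a. q ^ a - q ^ b)"
    by (rule prod.cong) (auto simp: qdist_def)
  also have "(\<Prod>j<k. qdist q a (Suc a + j)) = (\<Prod>j<k. q ^ (Suc a + j) - q ^ a)"
    by (rule prod.cong) (auto simp: qdist_def)
  finally show ?thesis
    unfolding prod_diff_below[OF assms] prod_diff_above[OF assms] by (simp add: power_add mult_ac)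
qed

lemma vand_lessThan_add:
  assumes "q \<noteq> 1"
  shows "vand {..<m + n} ((^) q) = vand {..<m} ((^) q) *
    (\<Prod>i=1..n. q ^ (m + i - 1 choose 2) * (q - 1) ^ (m + i - 1) * qfact q (m + i - 1))"
  by (induction n) (simp_all add: vand_lessThan_Suc prod_diff_below[OF assms] mult_ac)

lemma vand_interval: "vand {1..n} y = (\<Prod>i=1..n. \<Prod>j\<in>{i<..n}. y j - y i)"
proof -
  have "vand {1..n} y = (\<Prod>i=1..n. \<Prod>j | j \<in> {1..n} \<and> i < j. y j - y i)"
    unfolding vand_def by (rule prod.swap_restrict) auto
  also have "{j. j \<in> {1..n} \<and> i < j} = {i<..n}" if "i \<in> {1..n}" for i
    using that by auto
  then have "(\<Prod>i=1..n. \<Prod>j | j \<in> {1..n} \<and> i < j. y j - y i) = (\<Prod>i=1..n. \<Prod>j\<in>{i<..n}. y j - y i)"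
    by (intro prod.cong) auto
  finally show ?thesis .
qed

lemma choose_two_add: "(a + b choose 2) = (a choose 2) + (b choose 2) + a * b"
  by (induction b) (auto simp: numeral_2_eq_2)

text \<open>The number \<open>S i + i - 1\<close> is the position of the top edge of cell
  \<open>i\<close>, so the set on the left consists of the holes when all paths end at the tops. In
  \<open>vand_complement\<close> the tops yield the product over pairs, their \<open>qdists\<close>
  the denominator, and the growth from \<open>vand {..<m}\<close> to \<open>vand {..<m + n}\<close>
  the factorials of \<open>m + i - 1\<close>.\<close>

lemma vand_complement_eq_qfact:
  fixes S :: "nat \<Rightarrow> nat" and q :: "'a::field"
  assumes q: "\<And>k. k > 0 \<Longrightarrow> q ^ k \<noteq> 1" "q \<noteq> 0"
    and mono: "\<And>i j. i \<le> j \<Longrightarrow> S i \<le> S j" and Sn: "S n = m"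
  shows "vand ({..<m + n} - (\<lambda>i. S i + i - 1) ` {1..n}) ((^) q) *
      (\<Prod>i=1..n. qfact q (S i + i - 1) * qfact q (m - S i + n - i)) =
    vand {..<m} ((^) q) * (q ^ (\<Sum>i=1..n. (m - S i) choose 2) *
      ((\<Prod>(i, j) | 1 \<le> i \<and> i < j \<and> j \<le> n. qint q (S j - S i + j - i)) *
      (\<Prod>i=1..n. qfact q (m + i - 1))))"
proof -
  define P where "P = (\<lambda>i. S i + i - 1)"
  define C where "C = (\<lambda>i. m - S i)"
  define N where "N = m + n"
  define w where "w = (\<Prod>i=1..n. qdists q N (P i))"
  define Z where "Z = (\<Prod>i=1..n. \<Prod>j\<in>{i<..n}. qint q (P j - P i))"
  have q1: "q \<noteq> 1" using q(1)[of 1] by simp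
  have Sle: "S i \<le> m" if "i \<le> n" for i using mono[OF that] Sn by simp
  have strict: "P i < P j" if "1 \<le> i" "i < j" for i j
    using mono[of i j] that by (auto simp: P_def)
  have mono_P: "strict_mono_on {1..n} P"
    by (rule strict_mono_onI) (auto intro: strict)
  have PN: "P ` {1..n} \<subseteq> {..<N}" using Sle by (fastforce simp: P_def N_def)
  have inj: "inj_on P {1..n}" using mono_P by (rule strict_mono_on_imp_inj_on)
  have "{(i, j). 1 \<le> i \<and> i < j \<and> j \<le> n} = Sigma {1..n} (\<lambda>i. {i<..n})" by auto
  then have "(\<Prod>(i, j) | 1 \<le> i \<and> i < j \<and> j \<le> n. qint q (S j - S i + j - i)) =
      (\<Prod>i=1..n. \<Prod>j\<in>{i<..n}. qint q (S j - S i + j - i))"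
    by (simp only:) (subst prod.Sigma; simp)
  also have "\<dots> = Z"
    unfolding Z_def
  proof (intro prod.cong refl)
    fix i j assume "i \<in> {1..n}" "j \<in> {i<..n}"
    then have "S j - S i + j - i = P j - P i" using mono[of i j] by (simp add: P_def)
    then show "qint q (S j - S i + j - i) = qint q (P j - P i)" by simp
  qed
  finally have Z: "(\<Prod>(i, j) | 1 \<le> i \<and> i < j \<and> j \<le> n. qint q (S j - S i + j - i)) = Z" .
  have "vand (P ` {1..n}) ((^) q) = (\<Prod>i=1..n. \<Prod>j\<in>{i<..n}. q ^ P j - q ^ P i)"
    unfolding vand_reindex[OF mono_P] vand_interval by simp
  also have "\<dots> = (\<Prod>i=1..n. \<Prod>j\<in>{i<..n}. q ^ P i * (q - 1) * qint q (P j - P i))"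
  proof (intro prod.cong refl)
    fix i j assume "i \<in> {1..n}" "j \<in> {i<..n}"
    then show "q ^ P j - q ^ P i = q ^ P i * (q - 1) * qint q (P j - P i)"
      using strict[of i j] by (simp add: diff_power_eq_qint[OF q1] mult.assoc)
  qed
  also have "\<dots> = (\<Prod>i=1..n. (q ^ P i * (q - 1)) ^ (n - i)) * Z"
    by (simp add: Z_def prod.distrib)
  finally have vP: "vand (P ` {1..n}) ((^) q) = (\<Prod>i=1..n. (q ^ P i * (q - 1)) ^ (n - i)) * Z" .
  \<comment> \<open>Since \<open>m + i - 1 = P i + C i\<close>, the binomial splits by
    \<open>choose_two_add\<close>, and the surplus of powers of \<open>q\<close> is
    \<open>q ^ (C i choose 2)\<close>, the origin of the exponent \<open>\<alpha>\<close>. The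
    powers of \<open>q - 1\<close> agree: both have exponent \<open>m + n - 1\<close>.\<close>
  have term_eq: "q ^ (m + i - 1 choose 2) * (q - 1) ^ (m + i - 1) * qfact q (m + i - 1) *
      ((q ^ P i * (q - 1)) ^ (n - i) * (qfact q (P i) * qfact q (m - S i + n - i))) =
      qdists q N (P i) * (q ^ (C i choose 2) * qfact q (m + i - 1))" if i: "i \<in> {1..n}" for i
  proof -
    have M: "m + i - 1 = P i + C i" and K: "m - S i + n - i = C i + (n - i)"
      and "N = Suc (P i + (C i + (n - i)))"
      using i Sle[of i] by (auto simp: P_def C_def N_def)
    then have w: "qdists q N (P i) = q ^ ((P i choose 2) + P i * (C i + (n - i))) *
        (q - 1) ^ (P i + (C i + (n - i))) * (qfact q (P i) * qfact q (C i + (n - i)))"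
      by (simp only: qdists_eq_qfact[OF q1])
    show ?thesis
      unfolding w K M choose_two_add
      by (simp add: power_add power_mult_distrib power_mult[symmetric] distrib_left mult_ac)
  qed
  have "vand {..<N} ((^) q) * vand (P ` {1..n}) ((^) q) *
      (\<Prod>i=1..n. qfact q (P i) * qfact q (m - S i + n - i)) =
    vand {..<m} ((^) q) * Z *
      (\<Prod>i=1..n. q ^ (m + i - 1 choose 2) * (q - 1) ^ (m + i - 1) * qfact q (m + i - 1) *
      ((q ^ P i * (q - 1)) ^ (n - i) * (qfact q (P i) * qfact q (m - S i + n - i))))"
    unfolding vP N_def vand_lessThan_add[OF q1] by (simp add: prod.distrib mult_ac)
  also have "\<dots> = vand {..<m} ((^) q) * Z *
      (\<Prod>i=1..n. qdists q N (P i) * (q ^ (C i choose 2) * qfact q (m + i - 1)))"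
    by (simp only: prod.cong[OF refl term_eq])
  also have "\<dots> = w * (vand {..<m} ((^) q) * (q ^ (\<Sum>i=1..n. C i choose 2) *
      (Z * (\<Prod>i=1..n. qfact q (m + i - 1)))))"
    by (simp add: w_def prod.distrib power_sum mult_ac)
  finally have main: "vand {..<N} ((^) q) * vand (P ` {1..n}) ((^) q) *
      (\<Prod>i=1..n. qfact q (P i) * qfact q (m - S i + n - i)) =
    w * (vand {..<m} ((^) q) * (q ^ (\<Sum>i=1..n. C i choose 2) *
      (Z * (\<Prod>i=1..n. qfact q (m + i - 1)))))" .
  have comp: "vand {..<N} ((^) q) * vand (P ` {1..n}) ((^) q) =
      vand ({..<N} - P ` {1..n}) ((^) q) * w"
    using vand_complement[OF PN, of q] inj by (simp add: w_def prod.reindex)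
  have "w \<noteq> 0"
  proof -
    have "qdists q N (P i) \<noteq> 0" if "i \<in> {1..n}" for i
    proof -
      have "N = Suc (P i + (N - 1 - P i))" using PN that by fastforce
      then show ?thesis
        using qdists_eq_qfact[OF q1, of "P i" "N - 1 - P i"] q q1 qfact_nonzero[of q] by simp
    qed
    then show ?thesis by (simp add: w_def)
  qed
  moreover have "w * (vand ({..<N} - P ` {1..n}) ((^) q) *
      (\<Prod>i=1..n. qfact q (P i) * qfact q (m - S i + n - i))) =
    w * (vand {..<m} ((^) q) * (q ^ (\<Sum>i=1..n. C i choose 2) *
      (Z * (\<Prod>i=1..n. qfact q (m + i - 1)))))"
    unfolding main[symmetric] comp by (simp add: mult_ac)
  ultimately show ?thesis
    unfolding Z by (simp add: P_def C_def N_def)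
qed

lemma sum_transversals:
  assumes I: "finite I" and disj: "\<And>i j. i \<in> I \<Longrightarrow> j \<in> I \<Longrightarrow> i \<noteq> j \<Longrightarrow> B i \<inter> B j = {}"
    and V: "(\<Union>i\<in>I. B i) = V"
  shows "(\<Sum>A | A \<subseteq> V \<and> (\<forall>i\<in>I. card (A \<inter> B i) = 1). g A) = (\<Sum>f\<in>PiE I B. g (f ` I))"
proof (rule sum.reindex_bij_witness[of _ "\<lambda>f. f ` I" "\<lambda>A. restrict (\<lambda>i. the_elem (A \<inter> B i)) I"])
  have Int: "f ` I \<inter> B i = {f i}" if "f \<in> PiE I B" "i \<in> I" for f i
  proof -
    have mem: "f j \<in> B j" if "j \<in> I" for j using \<open>f \<in> PiE I B\<close> that by (rule PiE_mem)
    then show ?thesis using disj that(2) by blast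
  qed
  fix f assume f: "f \<in> PiE I B"
  show "restrict (\<lambda>i. the_elem (f ` I \<inter> B i)) I = f"
    by (rule ext) (use f Int[OF f] in \<open>auto simp: restrict_def PiE_def extensional_def\<close>)
  show "f ` I \<in> {A. A \<subseteq> V \<and> (\<forall>i\<in>I. card (A \<inter> B i) = 1)}"
    using Int[OF f] PiE_mem[OF f] V by auto
next
  fix A assume "A \<in> {A. A \<subseteq> V \<and> (\<forall>i\<in>I. card (A \<inter> B i) = 1)}"
  then have A: "A \<subseteq> V" and card: "\<And>i. i \<in> I \<Longrightarrow> card (A \<inter> B i) = 1" by auto
  define f where "f = restrict (\<lambda>i. the_elem (A \<inter> B i)) I"
  have Int: "A \<inter> B i = {f i}" if i: "i \<in> I" for i
  proof -
    obtain x where "A \<inter> B i = {x}" using card[OF i] by (rule card_1_singletonE)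
    then show ?thesis using i by (simp add: f_def)
  qed
  show "f \<in> PiE I B"
    using Int by (auto simp: f_def)
  have "A \<subseteq> (\<Union>i\<in>I. B i)" using A V by simp
  then show "f ` I = A"
    using Int by blast
  then show "g (f ` I) = g A" by simp
qed

text \<open>At \<open>c = m\<close> the weight per down-step in \<open>walker_sum\<close> has become
  \<open>t\<close>; after \<open>vand_complement\<close> the distance products, nonzero by the
  hypotheses on \<open>q\<close>, cancel.\<close>

lemma tiling_sum_left_region:
  fixes q t :: "'a::field"
  assumes q: "\<And>k. k > 0 \<Longrightarrow> q ^ k \<noteq> 1" "q \<noteq> 0" and A: "A \<subseteq> {..<n + m}" "card A = n"
  shows "tiling_sum lozenge (lozenge_weight q t) (left_region m n m A) * vand {..<m} ((^) q) =
    t ^ downs n m A * vand ({..<n + m} - A) ((^) q)"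
proof -
  let ?F = "\<lambda>c A. tiling_sum lozenge (lozenge_weight q t) (left_region m n c A)"
  define w where "w = (\<Prod>a\<in>A. qdists q (n + m) a)"
  have "?F m A * vand {..<m} ((^) q) * (\<Prod>a\<in>A. qdists q (n + m) a) =
      (q ^ (m - m) * t) ^ downs n m A * vand {..<n + m} ((^) q) * vand A ((^) q)"
  proof (rule walker_sum[where F = ?F and m = m])
    have "left_region m n 0 {..<n} = {}" by (auto simp: left_region_def)
    then show "?F 0 {..<n} = 1" by (simp add: tiling_sum_empty)
    show "?F (Suc c) B = (\<Sum>U | valid_step (n + c) B U.
        (q ^ (m - Suc c) * t) ^ card (B - U) * ?F c (step_back B U))"
      if "c < m" "B \<subseteq> {..<n + Suc c}" "card B = n" for c B
      using that by (intro tiling_sum_left_region_Suc lozenge_weight_ltri_rtri) auto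
  qed (use q A in auto)
  then have "?F m A * vand {..<m} ((^) q) * w = t ^ downs n m A * vand ({..<n + m} - A) ((^) q) * w"
    by (simp add: w_def vand_complement[OF A(1)] mult.assoc)
  moreover have "w \<noteq> 0"
  proof -
    have "qdists q (n + m) a \<noteq> 0" if a: "a \<in> A" for a
    proof -
      obtain k where k: "n + m = Suc (a + k)"
        using A(1) a less_imp_Suc_add[of a "n + m"] by blast
      show ?thesis
        unfolding k using qdists_eq_qfact[of q a k] q(1)[of 1] q qfact_nonzero[of q] by simp
    qed
    moreover have "finite A" using A(1) finite_subset by blast
    ultimately show ?thesis by (simp add: w_def)
  qed
  ultimately show ?thesis by simp
qed

lemma M_qt_nonzero:
  fixes m n :: nat and r S :: "nat \<Rightarrow> nat" and q t :: "'a::field"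
  assumes m: "m > 0" and r: "(\<Sum>i=1..n. r i) = m"
    and S: "\<And>k. S k = (\<Sum>i=1..k. r i)"
    and q: "\<And>k. k > 0 \<Longrightarrow> q ^ k \<noteq> 1" "q \<noteq> 0"
  shows "M_qt q t m n r * (\<Prod>i=1..n. qfact q (S i + i - 1) * qfact q (S n - S i + n - i)) =
    (\<Prod>i=1..m. 1 + q ^ (i - 1) * t) * q ^ (\<Sum>i=1..n. (S n - S i) choose 2)
    * t ^ (\<Sum>i=1..n. S n - S i)
    * ((\<Prod>(i, j) | 1 \<le> i \<and> i < j \<and> j \<le> n. qint q (S j - S i + j - i))
        * (\<Prod>i=1..n. qfact q (S n + i - 1)))"
proof -
  let ?I = "{1..n}" and ?B = "cell_edges r"
  \<comment> \<open>The bottom edge of cell \<open>i\<close>; \<open>P i\<close> is its top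
    edge.\<close>
  define lo where "lo = (\<lambda>i. \<Sum>j\<in>{1..<i}. r j + 1)"
  define P where "P = (\<lambda>i. S i + i - 1)"
  have S_Suc: "S (Suc k) = S k + r (Suc k)" for k by (simp add: S)
  have Sn: "S n = m" using r S[of n] by simp
  have mono: "S i \<le> S j" if "i \<le> j" for i j
    using that by (induction j rule: dec_induct) (simp_all add: S_Suc)
  have lo_Suc: "lo (Suc k) = S k + k" for k
    by (induction k) (simp_all add: lo_def S_Suc, simp add: S)
  have B: "?B i = {lo i..P i}" and lo_le: "lo i \<le> P i" if "i \<in> ?I" for i
  proof -
    have "?B i = {lo i..lo i + r i}" by (simp only: cell_edges_def lo_def)
    moreover have "lo i + r i = P i"
      using that lo_Suc[of "i - 1"] S_Suc[of "i - 1"] by (simp add: P_def)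
    ultimately show "?B i = {lo i..P i}" "lo i \<le> P i" by auto
  qed
  have Union_B: "(\<Union>i\<in>{1..k}. {lo i..P i}) = {..<S k + k}" for k
  proof (induction k)
    case (Suc k)
    have "{1..Suc k} = insert (Suc k) {1..k}" by auto
    then show ?case
      using Suc S_Suc[of k] by (auto simp: lo_Suc P_def)
  qed (simp add: S)
  have P_lo: "P i < lo j" if "i < j" "1 \<le> i" for i j
  proof -
    have "S i \<le> S (j - 1)" using that by (intro mono) simp
    moreover have "lo j = S (j - 1) + (j - 1)" using that lo_Suc[of "j - 1"] by simp
    ultimately show ?thesis using that unfolding P_def by linarith
  qed
  have disj: "{lo i..P i} \<inter> {lo j..P j} = {}" if "i \<in> ?I" "j \<in> ?I" "i \<noteq> j" for i j
    using that P_lo[of i j] P_lo[of j i] by (cases "i < j") auto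
  have UB: "(\<Union>i\<in>?I. ?B i) = {..<n + m}"
    using Union_B[of n] B by (simp add: Sn add.commute)
  \<comment> \<open>Every edge of a cell except the top one: the holes before any end point is
    lowered.\<close>
  define D where "D = (\<Union>i\<in>?I. {lo i..<P i})"
  have D: "D = {..<n + m} - P ` ?I"
  proof -
    have "D \<inter> P ` ?I = {}"
      using disj lo_le by (fastforce simp: D_def)
    moreover have "(\<Union>i\<in>?I. {lo i..P i}) = D \<union> P ` ?I"
      using lo_le by (force simp: D_def)
    ultimately show ?thesis using Union_B[of n] by (auto simp: Sn add.commute)
  qed
  have inj: "inj_on f ?I" if "f \<in> PiE ?I ?B" for f
  proof (rule inj_onI)
    fix i j assume "i \<in> ?I" "j \<in> ?I" "f i = f j"
    then show "i = j" using disj[of i j] B PiE_mem[OF that, of i] PiE_mem[OF that, of j] by auto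
  qed
  have PP: "restrict P ?I \<in> PiE ?I ?B" using B lo_le by auto
  have injP: "inj_on P ?I" using inj[OF PP] by (simp only: inj_on_restrict_eq)
  have sub: "f ` ?I \<subseteq> {..<n + m}" if "f \<in> PiE ?I ?B" for f
    using PiE_mem[OF that] UB by blast
  have subP: "P ` ?I \<subseteq> {..<n + m}" using sub[OF PP] by (simp only: image_restrict_eq)
  have cardD: "card D = m"
    unfolding D using subP injP by (subst card_Diff_subset) (auto simp: card_image)
  have sumP: "(\<Sum>i\<in>?I. P i) = (\<Sum>i\<in>?I. S i) + (n choose 2)"
  proof -
    have "(\<Sum>i=1..k. P i) = (\<Sum>i=1..k. S i) + (k choose 2)" for k
      by (induction k) (auto simp: P_def numeral_2_eq_2)
    then show ?thesis .
  qed
  \<comment> \<open>With all ends at the tops, the down-steps alone account for the exponent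
    \<open>\<beta>\<close>; the Pieri sum supplies the rest of the dependence on
    \<open>t\<close>.\<close>
  have downs_P: "downs n m (P ` ?I) = (\<Sum>i\<in>?I. S n - S i)"
  proof -
    have "(\<Sum>i\<in>?I. S n - S i) + (\<Sum>i\<in>?I. S i) = n * m"
      by (simp add: sum.distrib[symmetric] mono Sn[symmetric])
    moreover have "downs n m (P ` ?I) + (\<Sum>i\<in>?I. P i) = n * m + (n choose 2)"
      using downs_add_sum[OF subP] injP by (simp add: card_image sum.reindex)
    ultimately show ?thesis using sumP by simp
  qed
  have downs_f: "downs n m (f ` ?I) = downs n m (P ` ?I) + (\<Sum>i\<in>?I. P i - f i)"
    if f: "f \<in> PiE ?I ?B" for f
  proof -
    have "(\<Sum>i\<in>?I. P i - f i) + (\<Sum>i\<in>?I. f i) = (\<Sum>i\<in>?I. P i)"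
      using PiE_mem[OF f] B by (auto simp: sum.distrib[symmetric] intro!: sum.cong)
    moreover have "downs n m (f ` ?I) + (\<Sum>i\<in>?I. f i) = n * m + (n choose 2)"
      using downs_add_sum[OF sub[OF f]] inj[OF f] by (simp add: card_image sum.reindex)
    moreover have "downs n m (P ` ?I) + (\<Sum>i\<in>?I. P i) = n * m + (n choose 2)"
      using downs_add_sum[OF subP] injP by (simp add: card_image sum.reindex)
    ultimately show ?thesis by simp
  qed
  define V where "V = vand {..<m} ((^) q)"
  have "M_qt q t m n r = (\<Sum>A | A \<subseteq> {..<n + m} \<and> (\<forall>i\<in>?I. card (A \<inter> ?B i) = 1).
      tiling_sum lozenge (lozenge_weight q t) (left_region m n m A))"
    using m UB by (intro M_qt_eq_sum_tiling_sum) blast+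
  also have "\<dots> = (\<Sum>f\<in>PiE ?I ?B.
      tiling_sum lozenge (lozenge_weight q t) (left_region m n m (f ` ?I)))"
    using disj B by (intro sum_transversals UB) auto
  finally have "M_qt q t m n r * V = (\<Sum>f\<in>PiE ?I ?B.
      tiling_sum lozenge (lozenge_weight q t) (left_region m n m (f ` ?I)) * V)"
    by (simp add: sum_distrib_right)
  also have "\<dots> = (\<Sum>f\<in>PiE ?I ?B. t ^ downs n m (P ` ?I) *
      (t ^ (\<Sum>i\<in>?I. P i - f i) * vand ({..<n + m} - f ` ?I) ((^) q)))"
  proof (rule sum.cong[OF refl])
    fix f assume f: "f \<in> PiE ?I ?B"
    show "tiling_sum lozenge (lozenge_weight q t) (left_region m n m (f ` ?I)) * V =
      t ^ downs n m (P ` ?I) * (t ^ (\<Sum>i\<in>?I. P i - f i) * vand ({..<n + m} - f ` ?I) ((^) q))"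
    proof -
      have "card (f ` ?I) = n" using card_image[OF inj[OF f]] by simp
      from tiling_sum_left_region[OF q sub[OF f] this] show ?thesis
        unfolding V_def by (simp only: downs_f[OF f] power_add mult.assoc)
    qed
  qed
  also have "\<dots> = t ^ downs n m (P ` ?I) * (\<Sum>f\<in>PiE ?I (\<lambda>i. {lo i..P i}).
      t ^ (\<Sum>i\<in>?I. P i - f i) * vand ((\<Union>i\<in>?I. {lo i..P i}) - f ` ?I) ((^) q))"
  proof -
    have "PiE ?I ?B = PiE ?I (\<lambda>i. {lo i..P i})" by (rule PiE_cong) (rule B)
    moreover have "(\<Union>i\<in>?I. {lo i..P i}) = {..<n + m}" using Union_B[of n] by (simp add: Sn add.commute)
    ultimately show ?thesis by (simp only: sum_distrib_left)
  qed
  also have "\<dots> = t ^ downs n m (P ` ?I) * ((\<Prod>j<m. 1 + t * q ^ j) * vand D ((^) q))"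
  proof -
    have "(\<Sum>f\<in>PiE ?I (\<lambda>i. {lo i..P i}).
        t ^ (\<Sum>i\<in>?I. P i - f i) * vand ((\<Union>i\<in>?I. {lo i..P i}) - f ` ?I) ((^) q)) =
      (\<Prod>j<card D. 1 + t * q ^ j) * vand D ((^) q)"
      unfolding D_def by (rule pieri_blocks[OF finite_atLeastAtMost lo_le disj])
    then show ?thesis by (simp only: cardD)
  qed
  finally have MV: "M_qt q t m n r * V =
      t ^ downs n m (P ` ?I) * ((\<Prod>j<m. 1 + t * q ^ j) * vand D ((^) q))" .
  have "V \<noteq> 0"
    using vand_lessThan_add[of q 0 m] q(1)[of 1] q qfact_nonzero[of q]
    by (simp add: V_def vand_def[of "{}"])
  have VD: "vand D ((^) q) * (\<Prod>i=1..n. qfact q (S i + i - 1) * qfact q (m - S i + n - i)) =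
    V * (q ^ (\<Sum>i=1..n. (m - S i) choose 2) *
      ((\<Prod>(i, j) | 1 \<le> i \<and> i < j \<and> j \<le> n. qint q (S j - S i + j - i)) *
      (\<Prod>i=1..n. qfact q (m + i - 1))))"
    unfolding D V_def P_def add.commute[of n m]
    by (rule vand_complement_eq_qfact) (use q mono Sn in auto)
  have "V * (M_qt q t m n r * (\<Prod>i=1..n. qfact q (S i + i - 1) * qfact q (m - S i + n - i))) =
      (M_qt q t m n r * V) * (\<Prod>i=1..n. qfact q (S i + i - 1) * qfact q (m - S i + n - i))"
    by (simp only: mult_ac)
  also have "\<dots> = t ^ downs n m (P ` ?I) * (\<Prod>j<m. 1 + t * q ^ j) * (vand D ((^) q) *
      (\<Prod>i=1..n. qfact q (S i + i - 1) * qfact q (m - S i + n - i)))"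
    unfolding MV by (simp only: mult_ac)
  also have "\<dots> = V * ((\<Prod>j<m. 1 + t * q ^ j) * q ^ (\<Sum>i=1..n. (m - S i) choose 2)
      * t ^ downs n m (P ` ?I)
      * ((\<Prod>(i, j) | 1 \<le> i \<and> i < j \<and> j \<le> n. qint q (S j - S i + j - i))
        * (\<Prod>i=1..n. qfact q (m + i - 1))))"
    unfolding VD by (simp only: mult_ac)
  finally have "M_qt q t m n r * (\<Prod>i=1..n. qfact q (S i + i - 1) * qfact q (m - S i + n - i)) =
      (\<Prod>j<m. 1 + t * q ^ j) * q ^ (\<Sum>i=1..n. (m - S i) choose 2) * t ^ downs n m (P ` ?I)
      * ((\<Prod>(i, j) | 1 \<le> i \<and> i < j \<and> j \<le> n. qint q (S j - S i + j - i))
        * (\<Prod>i=1..n. qfact q (m + i - 1)))"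
    using \<open>V \<noteq> 0\<close> by (simp only: mult_cancel_left simp_thms)
  moreover have "(\<Prod>j<m. 1 + t * q ^ j) = (\<Prod>i=1..m. 1 + q ^ (i - 1) * t)"
    by (simp add: prod.atLeast1_atMost_eq mult.commute)
  ultimately show ?thesis
    unfolding downs_P unfolding Sn by (simp only:)
qed

section \<open>Specialisation of a polynomial identity\<close>

lemma to_fract_power: "to_fract (x ^ k) = to_fract x ^ k"
  by (induction k) simp_all

lemma to_fract_prod: "to_fract (prod f A) = (\<Prod>x\<in>A. to_fract (f x))"
  by (induction A rule: infinite_finite_induct) simp_all

lemma qint_to_fract:
  assumes "x \<noteq> 1"
  shows "qint (to_fract x) k = to_fract (\<Sum>i<k. x ^ i)"
proof -
  have "to_fract x \<noteq> 1" using assms by (metis to_fract_1 to_fract_eq_iff)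
  then show ?thesis by (simp add: qint_eq_sum to_fract_power)
qed

text \<open>
  For \<open>q = 0\<close> the Vandermonde products vanish, but both sides, cleared of denominators, are values
  at \<open>q = 0\<close> of polynomials that agree since they agree at the transcendental element
  \<open>X\<close> of the field of rational functions.
\<close>

lemma M_qt_zero:
  fixes m n :: nat and r S :: "nat \<Rightarrow> nat" and t :: "'a::field"
  assumes m: "m > 0" and r: "(\<Sum>i=1..n. r i) = m"
    and S: "\<And>k. S k = (\<Sum>i=1..k. r i)"
  defines "q \<equiv> 0 :: 'a"
  shows "M_qt q t m n r * (\<Prod>i=1..n. qfact q (S i + i - 1) * qfact q (S n - S i + n - i)) =
    (\<Prod>i=1..m. 1 + q ^ (i - 1) * t) * q ^ (\<Sum>i=1..n. (S n - S i) choose 2)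
    * t ^ (\<Sum>i=1..n. S n - S i)
    * ((\<Prod>(i, j) | 1 \<le> i \<and> i < j \<and> j \<le> n. qint q (S j - S i + j - i))
        * (\<Prod>i=1..n. qfact q (S n + i - 1)))"
proof -
  define X T where "X = [:0, 1 :: 'a:]" and "T = [:t:]"
  define qi where "qi k = (\<Sum>i<k. X ^ i)" for k
  define qf where "qf k = (\<Prod>i=1..k. qi i)" for k
  \<comment> \<open>The generating function as a polynomial in \<open>X\<close>; \<open>M_qt\<close>
    itself is defined over fields only.\<close>
  define M where "M = (\<Sum>\<tau>\<in>block_diag_symmetric_tilings m n r. \<Prod>L | L \<in> \<tau> \<and> left_of_diagonal L.
    if negative L then X ^ nat (- Max (fst ` \<Union>L)) * T else 1)"
  have "X ^ k \<noteq> 1" if "k > 0" for k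
  proof
    assume "X ^ k = 1"
    then have "poly (X ^ k) 0 = poly 1 0" by simp
    then show False using that by (simp add: X_def zero_power)
  qed
  then have Xk: "to_fract X ^ k \<noteq> 1" if "k > 0" for k
    using that by (metis to_fract_1 to_fract_eq_iff to_fract_power)
  have X: "X \<noteq> 1" "to_fract X \<noteq> 0" by (simp_all add: X_def one_pCons)
  have qint: "qint (to_fract X) k = to_fract (qi k)" for k
    unfolding qi_def by (rule qint_to_fract[OF X(1)])
  have qfact: "qfact (to_fract X) k = to_fract (qf k)" for k
    by (simp add: qfact_def qf_def qint to_fract_prod)
  have MX: "M_qt (to_fract X) (to_fract T) m n r = to_fract M"
    by (simp add: M_qt_def M_def tiling_weight_def to_fract_prod)
      (intro sum.cong prod.cong refl, simp add: lozenge_weight_def to_fract_power)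
  have "to_fract (M * (\<Prod>i=1..n. qf (S i + i - 1) * qf (S n - S i + n - i))) =
    to_fract ((\<Prod>i=1..m. 1 + X ^ (i - 1) * T) * X ^ (\<Sum>i=1..n. (S n - S i) choose 2)
    * T ^ (\<Sum>i=1..n. S n - S i)
    * ((\<Prod>(i, j) | 1 \<le> i \<and> i < j \<and> j \<le> n. qi (S j - S i + j - i))
        * (\<Prod>i=1..n. qf (S n + i - 1))))"
    using M_qt_nonzero[OF m r S Xk X(2), where t = "to_fract T"]
    by (simp only: MX qint qfact to_fract_mult to_fract_prod to_fract_power to_fract_add to_fract_1
        case_prod_unfold)
  then have "poly (M * (\<Prod>i=1..n. qf (S i + i - 1) * qf (S n - S i + n - i))) 0 =
    poly ((\<Prod>i=1..m. 1 + X ^ (i - 1) * T) * X ^ (\<Sum>i=1..n. (S n - S i) choose 2)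
    * T ^ (\<Sum>i=1..n. S n - S i)
    * ((\<Prod>(i, j) | 1 \<le> i \<and> i < j \<and> j \<le> n. qi (S j - S i + j - i))
        * (\<Prod>i=1..n. qf (S n + i - 1)))) 0"
    by (simp only: to_fract_eq_iff)
  moreover have "poly X 0 = q" "poly T 0 = t" by (simp_all add: X_def T_def q_def)
  moreover have qi0: "poly (qi k) 0 = qint q k" for k
    by (simp add: qi_def qint_eq_sum q_def poly_sum X_def)
  moreover have "poly (qf k) 0 = qfact q k" for k
    by (simp add: qf_def qfact_def poly_prod qi0)
  moreover have "poly M 0 = M_qt q t m n r"
    by (simp add: M_qt_def M_def tiling_weight_def poly_sum poly_prod)
      (intro sum.cong prod.cong refl, simp add: lozenge_weight_def X_def T_def q_def)
  ultimately show ?thesis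
    by (simp only: poly_mult poly_prod poly_power poly_add poly_1 case_prod_unfold)
qed

theorem theorem2p4:
  fixes m n :: nat and r S :: "nat \<Rightarrow> nat" and q t :: "'a::field"
  assumes "m > 0" and "n > 0"
    and "(\<Sum>i=1..n. r i) = m"
    and "\<And>k. S k = (\<Sum>i=1..k. r i)"
    and "\<And>k. k > 0 \<Longrightarrow> q ^ k \<noteq> 1"
  shows "M_qt q t m n r =
    (\<Prod>i=1..m. 1 + q ^ (i - 1) * t)
    * q ^ (\<Sum>i=1..n. (S n - S i) choose 2)
    * t ^ (\<Sum>i=1..n. S n - S i)
    * (((\<Prod>(i, j) | 1 \<le> i \<and> i < j \<and> j \<le> n. qint q (S j - S i + j - i))
        * (\<Prod>i=1..n. qfact q (S n + i - 1)))
       / (\<Prod>i=1..n. qfact q (S i + i - 1) * qfact q (S n - S i + n - i)))"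
proof -
  have "(\<Prod>i=1..n. qfact q (S i + i - 1) * qfact q (S n - S i + n - i)) \<noteq> 0"
    using qfact_nonzero[OF assms(5)] by simp
  moreover have "M_qt q t m n r * (\<Prod>i=1..n. qfact q (S i + i - 1) * qfact q (S n - S i + n - i)) =
    (\<Prod>i=1..m. 1 + q ^ (i - 1) * t) * q ^ (\<Sum>i=1..n. (S n - S i) choose 2)
    * t ^ (\<Sum>i=1..n. S n - S i)
    * ((\<Prod>(i, j) | 1 \<le> i \<and> i < j \<and> j \<le> n. qint q (S j - S i + j - i))
        * (\<Prod>i=1..n. qfact q (S n + i - 1)))"
  proof (cases "q = 0")
    case True
    show ?thesis unfolding True by (rule M_qt_zero[OF assms(1,3,4)])
  next
    case False
    show ?thesis by (rule M_qt_nonzero[OF assms(1,3,4,5) False])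
  qed
  ultimately show ?thesis
    unfolding times_divide_eq_right by (rule nonzero_eq_divide_eq[THEN iffD2])
qed

end
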